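(* Let $\mathfrak{C}$ be a class of finite groups closed under subgroups, quotients, finite direct products and extensions. Let $(X,\bar R,\omega)$ be a presentation of a pro-$\mathfrak{C}$-group $G$ and let $F^{(1)}$ be the first step of the step-by-step construction of the simplicial pro-$\mathfrak{C}$-resolution of $G$ from this presentation. Then $\pi_1(F^{(1)})\cong\pi_P(G)$, where $\pi_P(G)$ is the module of identities among the relations of the presentation.
   Context: $F_{\mathfrak{C}}(Y)$ is the free pro-$\mathfrak{C}$-group on a profinite space $Y$. A presentation $(X,\bar R,\omega)$ of $G$ consists of profinite spaces $X,\bar R$ and a continuous map $\omega:\bar R\to F=F_{\mathfrak{C}}(X)$ such that $1\to N(R)\to F\to G\to1$ is exact, where $N(R)$ is the closed normal subgroup generated by $R=\omega(\bar R)$. Let $H$ be the closed normal closure of $\bar R$ in $F_{\mathfrak{C}}(X\cup\bar R)$ (disjoint union), with $F$ acting by conjugation ${}^uh$, and $\Theta:H\to F$ the restriction of the homomorphism with $x\mapsto x$ ($x\in X$), $\rho\mapsto\omega(\rho)$ ($\rho\in\bar R$). Let $P$ be the closed subgroup of $H$ generated by the Peiffer commutators $\langle a,b\rangle=aba^{-1}({}^{\Theta(a)}b)^{-1}$, $a,b\in H$, and $\partial:H/P\to F$ the induced homomorphism (the crossed module of the presentation). The module of identities among the relations is $\pi_P(G)=\ker(\partial:H/P\to F)$. The simplicial pro-$\mathfrak{C}$-group $F^{(1)}$: $F^{(1)}_n$ is the free pro-$\mathfrak{C}$-group on $X\cup\bigcup_{t:[n]\twoheadrightarrow[1]}\bar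 R_t$, where $\bar R_t=\{\rho_t:\rho\in\bar R\}$ is a copy of $\bar R$ for each monotone surjection $t$ (so $F_0^{(1)}=F$, $F_1^{(1)}=F_{\mathfrak{C}}(X\cup\bar R)$). All faces and degeneracies fix $X$; $s_i(\rho_t)=\rho_{t\alpha_i}$ with $\alpha_i:[n+1]\to[n]$ the monotone surjection hitting $i$ twice; with $\delta_i:[n-1]\to[n]$ the monotone injection missing $i$, $d_i(\rho_t)=\rho_{t\delta_i}$ if $t\delta_i$ is surjective, $\omega(\rho)$ if $t\delta_i$ is constant $0$, and $1$ if $t\delta_i$ is constant $1$. $\pi_1$ is the first homology group of the Moore complex $NF^{(1)}_n=\bigcap_{i=0}^{n-1}\ker d_i^n$ with differential $d_n^n$. *)

theory Defs
  imports "HOL-Analysis.Analysis" "HOL-Algebra.Product_Groups"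
begin

section \<open>Profinite spaces and pro-C groups\<close>

definition profinite_space :: "'a topology \<Rightarrow> bool" where
  "profinite_space X \<longleftrightarrow> compact_space X \<and> Hausdorff_space X \<and>
     (\<forall>S. connectedin X S \<longrightarrow> (\<exists>a. S \<subseteq> {a}))"

text \<open>A class of finite groups is given by its members with carrier in \<^typ>\<open>nat\<close>; every finite group
  has such a copy, and membership of groups over other types is membership of a copy. The class is
  nonempty as soon as some pro-C group exists.\<close>

definition in_class :: "nat monoid set \<Rightarrow> ('a, 'm) monoid_scheme \<Rightarrow> bool" where
  "in_class C G \<longleftrightarrow> (\<exists>Q\<in>C. G \<cong> Q)"

definition closed_class :: "nat monoid set \<Rightarrow> bool" where
  "closed_class C \<longleftrightarrow>
     (\<forall>Q\<in>C. group Q \<and> finite (carrier Q)) \<and>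
     (\<forall>Q\<in>C. \<forall>K. subgroup K Q \<longrightarrow> in_class C (Q\<lparr>carrier := K\<rparr>)) \<and>
     (\<forall>Q\<in>C. \<forall>N. N \<lhd> Q \<longrightarrow> in_class C (Q Mod N)) \<and>
     (\<forall>Q\<in>C. \<forall>Q'\<in>C. in_class C (Q \<times>\<times> Q')) \<and>
     (\<forall>(E :: nat monoid) N. group E \<and> finite (carrier E) \<and> N \<lhd> E \<and>
        in_class C (E\<lparr>carrier := N\<rparr>) \<and> in_class C (E Mod N) \<longrightarrow> in_class C E)"

definition topological_group :: "('a, 'm) monoid_scheme \<Rightarrow> 'a topology \<Rightarrow> bool" where
  "topological_group G T \<longleftrightarrow> group G \<and> topspace T = carrier G \<and>
     continuous_map (prod_topology T T) T (\<lambda>(x, y). x \<otimes>\<^bsub>G\<^esub> y) \<and>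
     continuous_map T T (\<lambda>x. inv\<^bsub>G\<^esub> x)"

text \<open>Inverse limits of groups in the class: compact Hausdorff groups in which the open normal
  subgroups with quotient in the class form a neighbourhood base of the identity.\<close>

definition proC_group :: "nat monoid set \<Rightarrow> ('a, 'm) monoid_scheme \<Rightarrow> 'a topology \<Rightarrow> bool" where
  "proC_group C G T \<longleftrightarrow> topological_group G T \<and> compact_space T \<and> Hausdorff_space T \<and>
     (\<forall>U. openin T U \<and> \<one>\<^bsub>G\<^esub> \<in> U \<longrightarrow>
        (\<exists>N. N \<lhd> G \<and> openin T N \<and> N \<subseteq> U \<and> in_class C (G Mod N)))"

definition closed_span :: "('a, 'm) monoid_scheme \<Rightarrow> 'a topology \<Rightarrow> 'a set \<Rightarrow> 'a set" where
  "closed_span G T S = \<Inter>{K. subgroup K G \<and> closedin T K \<and> S \<subseteq> K}"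

definition closed_normal_span :: "('a, 'm) monoid_scheme \<Rightarrow> 'a topology \<Rightarrow> 'a set \<Rightarrow> 'a set" where
  "closed_normal_span G T S = \<Inter>{K. K \<lhd> G \<and> closedin T K \<and> S \<subseteq> K}"

definition final_topology :: "'a topology \<Rightarrow> ('a \<Rightarrow> 'b) \<Rightarrow> 'b topology" where
  "final_topology T q =
     topology (\<lambda>U. U \<subseteq> q ` topspace T \<and> openin T {x \<in> topspace T. q x \<in> U})"

lemma openin_final_topology:
  "openin (final_topology T q) U \<longleftrightarrow> U \<subseteq> q ` topspace T \<and> openin T {x \<in> topspace T. q x \<in> U}"
proof -
  have "istopology (\<lambda>U. U \<subseteq> q ` topspace T \<and> openin T {x \<in> topspace T. q x \<in> U})"
    unfolding istopology_def
  proof (intro conjI allI impI)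
    fix S S' assume a: "S \<subseteq> q ` topspace T \<and> openin T {x \<in> topspace T. q x \<in> S}"
      "S' \<subseteq> q ` topspace T \<and> openin T {x \<in> topspace T. q x \<in> S'}"
    show "S \<inter> S' \<subseteq> q ` topspace T" using a by blast
    have "{x \<in> topspace T. q x \<in> S \<inter> S'} = {x \<in> topspace T. q x \<in> S} \<inter> {x \<in> topspace T. q x \<in> S'}" by auto
    then show "openin T {x \<in> topspace T. q x \<in> S \<inter> S'}" using a by auto
  next
    fix \<K> assume a: "\<forall>K\<in>\<K>. K \<subseteq> q ` topspace T \<and> openin T {x \<in> topspace T. q x \<in> K}"
    show "\<Union>\<K> \<subseteq> q ` topspace T" using a by blast
    have "{x \<in> topspace T. q x \<in> \<Union>\<K>} = (\<Union>K\<in>\<K>. {x \<in> topspace T. q x \<in> K})" by auto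
    then show "openin T {x \<in> topspace T. q x \<in> \<Union>\<K>}" using a by auto
  qed
  then show ?thesis by (simp add: final_topology_def)
qed

definition quotient_topology :: "('a, 'm) monoid_scheme \<Rightarrow> 'a topology \<Rightarrow> 'a set \<Rightarrow> 'a set topology" where
  "quotient_topology G T N = final_topology T (\<lambda>x. N #>\<^bsub>G\<^esub> x)"

definition plus_topology :: "'a topology \<Rightarrow> 'b topology \<Rightarrow> ('a + 'b) topology" where
  "plus_topology X Y = topology (\<lambda>U. U \<subseteq> topspace X <+> topspace Y \<and>
     openin X (Inl -` U) \<and> openin Y (Inr -` U))"

lemma openin_plus_topology:
  "openin (plus_topology X Y) U \<longleftrightarrow> U \<subseteq> topspace X <+> topspace Y \<and>
     openin X (Inl -` U) \<and> openin Y (Inr -` U)"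
proof -
  have "istopology (\<lambda>U. U \<subseteq> topspace X <+> topspace Y \<and> openin X (Inl -` U) \<and> openin Y (Inr -` U))"
    unfolding istopology_def
    by (auto simp: vimage_Union)
  then show ?thesis by (simp add: plus_topology_def)
qed

lemma topspace_plus_topology [simp]:
  "topspace (plus_topology X Y) = topspace X <+> topspace Y"
proof -
  have "Inl -` (topspace X <+> topspace Y) = topspace X" "Inr -` (topspace X <+> topspace Y) = topspace Y"
    by auto
  then have "openin (plus_topology X Y) (topspace X <+> topspace Y)"
    by (simp add: openin_plus_topology)
  then show ?thesis
    by (metis openin_plus_topology openin_subset openin_topspace subset_antisym)
qed


section \<open>Free pro-C groups\<close>

text \<open>The free pro-C group on \<^term>\<open>Y\<close> is the closed subgroup generated by the image of \<^term>\<open>Y\<close> in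
  the product of all groups of the class indexed by the continuous maps from \<^term>\<open>Y\<close> to them.
  The universal property, with respect to pro-C groups over arbitrary types, is
  \<open>free_proC_universal\<close> below.\<close>

type_synonym 'y fpc = "nat monoid \<times> ('y \<Rightarrow> nat) \<Rightarrow> nat"

definition free_index :: "nat monoid set \<Rightarrow> 'y topology \<Rightarrow> (nat monoid \<times> ('y \<Rightarrow> nat)) set" where
  "free_index C Y = {(Q, f). Q \<in> C \<and> continuous_map Y (discrete_topology (carrier Q)) f}"

definition free_prod :: "nat monoid set \<Rightarrow> 'y topology \<Rightarrow> 'y fpc monoid" where
  "free_prod C Y = product_group (free_index C Y) fst"

definition free_prod_top :: "nat monoid set \<Rightarrow> 'y topology \<Rightarrow> 'y fpc topology" where
  "free_prod_top C Y = product_topology (\<lambda>i. discrete_topology (carrier (fst i))) (free_index C Y)"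

definition free_gen :: "nat monoid set \<Rightarrow> 'y topology \<Rightarrow> 'y \<Rightarrow> 'y fpc" where
  "free_gen C Y y = (\<lambda>i\<in>free_index C Y. snd i y)"

definition free_proC :: "nat monoid set \<Rightarrow> 'y topology \<Rightarrow> 'y fpc monoid" where
  "free_proC C Y = (free_prod C Y)
     \<lparr>carrier := closed_span (free_prod C Y) (free_prod_top C Y) (free_gen C Y ` topspace Y)\<rparr>"

definition free_proC_top :: "nat monoid set \<Rightarrow> 'y topology \<Rightarrow> 'y fpc topology" where
  "free_proC_top C Y = subtopology (free_prod_top C Y) (carrier (free_proC C Y))"

definition free_lift ::
  "nat monoid set \<Rightarrow> 'y topology \<Rightarrow> ('h, 'm) monoid_scheme \<Rightarrow> 'h topology \<Rightarrow> ('y \<Rightarrow> 'h) \<Rightarrow> 'y fpc \<Rightarrow> 'h" where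
  "free_lift C Y H TH f = (THE \<phi>. \<phi> \<in> extensional (carrier (free_proC C Y)) \<and>
     \<phi> \<in> hom (free_proC C Y) H \<and> continuous_map (free_proC_top C Y) TH \<phi> \<and>
     (\<forall>y\<in>topspace Y. \<phi> (free_gen C Y y) = f y))"

lemma prod_topology_discrete:
  "prod_topology (discrete_topology A) (discrete_topology B) = discrete_topology (A \<times> B)"
proof -
  have "openin (prod_topology (discrete_topology A) (discrete_topology B)) {x}" if "x \<in> A \<times> B" for x
  proof -
    have "{x} = {fst x} \<times> {snd x}" by auto
    then show ?thesis using that by (metis (no_types) mem_Times_iff openin_discrete_topology openin_prod_Times_iff empty_subsetI insert_subset)
  qed
  then show ?thesis by (metis discrete_topology_unique topspace_discrete_topology topspace_prod_topology)
qed

lemma topological_group_subgroup: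
  assumes T: "topological_group G T" and K: "subgroup K G"
  shows "topological_group (G\<lparr>carrier := K\<rparr>) (subtopology T K)"
proof -
  interpret group G using T by (simp add: topological_group_def)
  have sub: "K \<subseteq> carrier G" using K by (rule subgroup.subset)
  have gK: "group (G\<lparr>carrier := K\<rparr>)" using K by (rule subgroup_imp_group)
  have top: "topspace (subtopology T K) = K"
    using T sub by (auto simp: topological_group_def)
  have 1: "continuous_map (prod_topology (subtopology T K) (subtopology T K)) (subtopology T K) (\<lambda>(x, y). x \<otimes>\<^bsub>G\<^esub> y)"
    unfolding continuous_map_in_subtopology
  proof
    have "continuous_map (prod_topology T T) T (\<lambda>(x, y). x \<otimes>\<^bsub>G\<^esub> y)"
      using T by (simp add: topological_group_def)
    then show "continuous_map (prod_topology (subtopology T K) (subtopology T K)) T (\<lambda>(x, y). x \<otimes>\<^bsub>G\<^esub> y)"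
      unfolding prod_topology_subtopology 
      by (auto intro!: continuous_map_from_subtopology)
  qed (use top subgroup.m_closed[OF K] in auto)
  have 2: "continuous_map (subtopology T K) (subtopology T K) (\<lambda>x. inv\<^bsub>G\<lparr>carrier := K\<rparr>\<^esub> x)"
  proof (rule continuous_map_eq)
    show "continuous_map (subtopology T K) (subtopology T K) (\<lambda>x. inv\<^bsub>G\<^esub> x)"
      using T top subgroup.m_inv_closed[OF K]
      by (auto simp: continuous_map_in_subtopology topological_group_def intro!: continuous_map_from_subtopology)
    show "\<And>x. x \<in> topspace (subtopology T K) \<Longrightarrow> inv\<^bsub>G\<^esub> x = inv\<^bsub>G\<lparr>carrier := K\<rparr>\<^esub> x"
      using top m_inv_consistent[OF K] by auto
  qed
  show ?thesis unfolding topological_group_def using gK top 1 2 by simp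
qed

lemma subgroup_Inter_ne:
  assumes "group G" "\<And>K. K \<in> A \<Longrightarrow> subgroup K G" "A \<noteq> {}"
  shows "subgroup (\<Inter>A) G"
  using assms by (simp add: group.subgroups_Inter)

lemma closed_span_props:
  assumes T: "topological_group G T" and S: "S \<subseteq> carrier G"
  shows "subgroup (closed_span G T S) G" "closedin T (closed_span G T S)" "S \<subseteq> closed_span G T S"
proof -
  let ?A = "{K. subgroup K G \<and> closedin T K \<and> S \<subseteq> K}"
  have g: "group G" and t: "topspace T = carrier G" using T by (auto simp: topological_group_def)
  have ne: "carrier G \<in> ?A" using group.subgroup_self[OF g] S t by (metis (mono_tags) closedin_topspace mem_Collect_eq)
  show "subgroup (closed_span G T S) G" unfolding closed_span_def
    using subgroup_Inter_ne[OF g, of ?A] ne by blast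
  show "closedin T (closed_span G T S)" unfolding closed_span_def
    using ne by (intro closedin_Inter) auto
  show "S \<subseteq> closed_span G T S" unfolding closed_span_def by blast
qed

lemma closed_span_least:
  "subgroup K G \<Longrightarrow> closedin T K \<Longrightarrow> S \<subseteq> K \<Longrightarrow> closed_span G T S \<subseteq> K"
  unfolding closed_span_def by blast

lemma free_prod_group: "closed_class C \<Longrightarrow> group (free_prod C Y)"
  unfolding free_prod_def by (rule product_group) (auto simp: free_index_def closed_class_def)

lemma free_prod_topological:
  assumes C: "closed_class C"
  shows "topological_group (free_prod C Y) (free_prod_top C Y)"
proof -
  let ?I = "free_index C Y"
  have g: "\<And>i. i \<in> ?I \<Longrightarrow> group (fst i)" using C by (auto simp: free_index_def closed_class_def)
  have top: "topspace (free_prod_top C Y) = carrier (free_prod C Y)"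
    by (simp add: free_prod_top_def free_prod_def)
  have pr: "continuous_map (free_prod_top C Y) (discrete_topology (carrier (fst i))) (\<lambda>x. x i)" if "i \<in> ?I" for i
    unfolding free_prod_top_def using that by (rule continuous_map_product_projection)
  have 1: "continuous_map (prod_topology (free_prod_top C Y) (free_prod_top C Y)) (free_prod_top C Y)
     (\<lambda>(x, y). x \<otimes>\<^bsub>free_prod C Y\<^esub> y)"
    unfolding free_prod_top_def[of C Y] continuous_map_componentwise
  proof (intro conjI ballI)
    fix i assume i: "i \<in> ?I"
    interpret group "fst i" using g i .
    let ?D = "discrete_topology (carrier (fst i))"
    have m: "continuous_map (prod_topology ?D ?D) ?D (\<lambda>(a,b). a \<otimes>\<^bsub>fst i\<^esub> b)"
      by (auto simp: prod_topology_discrete)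
    have p: "continuous_map (prod_topology (free_prod_top C Y) (free_prod_top C Y)) (prod_topology ?D ?D) (\<lambda>(x,y). (x i, y i))"
      using pr[OF i] by (simp add: continuous_map_prod_top)
    have "continuous_map (prod_topology (free_prod_top C Y) (free_prod_top C Y)) ?D ((\<lambda>(a,b). a \<otimes>\<^bsub>fst i\<^esub> b) \<circ> (\<lambda>(x,y). (x i, y i)))"
      using p m by (rule continuous_map_compose)
    then show "continuous_map (prod_topology (product_topology (\<lambda>i. discrete_topology (carrier (fst i))) ?I) (product_topology (\<lambda>i. discrete_topology (carrier (fst i))) ?I)) ?D (\<lambda>x. (case x of (x,y) \<Rightarrow> x \<otimes>\<^bsub>free_prod C Y\<^esub> y) i)"
      unfolding free_prod_top_def[symmetric]
      by (rule continuous_map_eq) (use i in \<open>auto simp: free_prod_def\<close>)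
  qed (auto simp: free_prod_def)
  have 2: "continuous_map (free_prod_top C Y) (free_prod_top C Y) (\<lambda>x. inv\<^bsub>free_prod C Y\<^esub> x)"
  proof (rule continuous_map_eq)
    show "continuous_map (free_prod_top C Y) (free_prod_top C Y) (\<lambda>x. \<lambda>i\<in>?I. inv\<^bsub>fst i\<^esub> (x i))"
      unfolding free_prod_top_def[of C Y] continuous_map_componentwise
    proof (intro conjI ballI)
      fix i assume i: "i \<in> ?I"
      interpret group "fst i" using g i .
      let ?D = "discrete_topology (carrier (fst i))"
      have "continuous_map ?D ?D (\<lambda>a. inv\<^bsub>fst i\<^esub> a)" by auto
      then have "continuous_map (free_prod_top C Y) ?D ((\<lambda>a. inv\<^bsub>fst i\<^esub> a) \<circ> (\<lambda>x. x i))"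
        using pr[OF i] continuous_map_compose by blast
      then show "continuous_map (product_topology (\<lambda>i. discrete_topology (carrier (fst i))) ?I) ?D (\<lambda>x. (\<lambda>i\<in>?I. inv\<^bsub>fst i\<^esub> (x i)) i)"
        unfolding free_prod_top_def[symmetric]
        by (rule continuous_map_eq) (use i in auto)
    qed auto
    show "(\<lambda>i\<in>?I. inv\<^bsub>fst i\<^esub> (x i)) = inv\<^bsub>free_prod C Y\<^esub> x" if "x \<in> topspace (free_prod_top C Y)" for x
      using that top g unfolding free_prod_def by (subst inv_product_group) auto
  qed
  show ?thesis unfolding topological_group_def using free_prod_group[OF C] top 1 2 by simp
qed

lemma free_gen_carrier:
  "free_gen C Y ` topspace Y \<subseteq> carrier (free_prod C Y)"
proof (rule image_subsetI)
  fix y assume y: "y \<in> topspace Y"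
  have "snd i y \<in> carrier (fst i)" if "i \<in> free_index C Y" for i
  proof -
    have "continuous_map Y (discrete_topology (carrier (fst i))) (snd i)"
      using that by (auto simp only: free_index_def mem_Collect_eq case_prod_beta)
    then show ?thesis using y continuous_map_image_subset_topspace by fastforce
  qed
  then show "free_gen C Y y \<in> carrier (free_prod C Y)" by (auto simp: free_gen_def free_prod_def)
qed

lemma free_gen_in_free: 
  assumes "closed_class C" "y \<in> topspace Y" shows "free_gen C Y y \<in> carrier (free_proC C Y)"
  using closed_span_props(3)[OF free_prod_topological[OF assms(1), of Y] free_gen_carrier] assms(2)
  by (auto simp: free_proC_def)

lemma free_subgroup: "closed_class C \<Longrightarrow> subgroup (carrier (free_proC C Y)) (free_prod C Y)"
  using closed_span_props(1)[OF free_prod_topological free_gen_carrier]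
  by (simp add: free_proC_def)

lemma free_closedin: "closed_class C \<Longrightarrow> closedin (free_prod_top C Y) (carrier (free_proC C Y))"
  using closed_span_props(2)[OF free_prod_topological free_gen_carrier]
  by (simp add: free_proC_def)

lemma free_proC_eq: "free_proC C Y = (free_prod C Y)\<lparr>carrier := carrier (free_proC C Y)\<rparr>"
  by (simp add: free_proC_def)

lemma free_proC_topological: "closed_class C \<Longrightarrow> topological_group (free_proC C Y) (free_proC_top C Y)"
  unfolding free_proC_top_def
  by (subst free_proC_eq, rule topological_group_subgroup[OF free_prod_topological free_subgroup])

lemma free_prod_compact: "closed_class C \<Longrightarrow> compact_space (free_prod_top C Y)"
  unfolding free_prod_top_def
  by (auto simp: compact_space_product_topology compact_space_discrete_topology free_index_def closed_class_def)

lemma free_prod_Hausdorff: "Hausdorff_space (free_prod_top C Y)"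
  unfolding free_prod_top_def
  by (auto simp: Hausdorff_space_product_topology)

lemma free_proC_compact: "closed_class C \<Longrightarrow> compact_space (free_proC_top C Y)"
  unfolding free_proC_top_def
  by (simp add: closedin_compact_space compact_space_subtopology free_closedin free_prod_compact)

lemma free_proC_Hausdorff: "Hausdorff_space (free_proC_top C Y)"
  unfolding free_proC_top_def by (simp add: Hausdorff_space_subtopology free_prod_Hausdorff)

lemma free_gen_continuous: 
  assumes C: "closed_class C" shows "continuous_map Y (free_proC_top C Y) (free_gen C Y)"
  unfolding free_proC_top_def continuous_map_in_subtopology
proof
  show "continuous_map Y (free_prod_top C Y) (free_gen C Y)"
    unfolding free_prod_top_def continuous_map_componentwise
  proof (intro conjI ballI)
    fix i assume i: "i \<in> free_index C Y"
    then have "continuous_map Y (discrete_topology (carrier (fst i))) (snd i)"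
      by (auto simp only: free_index_def mem_Collect_eq case_prod_beta)
    then show "continuous_map Y (discrete_topology (carrier (fst i))) (\<lambda>x. free_gen C Y x i)"
      by (rule continuous_map_eq) (use i in \<open>auto simp: free_gen_def\<close>)
  qed (auto simp: free_gen_def)
qed (use free_gen_in_free[OF C] in auto)

lemma free_lift_unique:
  assumes C: "closed_class C" and H: "group H" and TH: "Hausdorff_space TH"
    and 1: "\<phi> \<in> hom (free_proC C Y) H" "continuous_map (free_proC_top C Y) TH \<phi>"
    and 2: "\<psi> \<in> hom (free_proC C Y) H" "continuous_map (free_proC_top C Y) TH \<psi>"
    and eq: "\<And>y. y \<in> topspace Y \<Longrightarrow> \<phi> (free_gen C Y y) = \<psi> (free_gen C Y y)"
    and z: "z \<in> carrier (free_proC C Y)"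
  shows "\<phi> z = \<psi> z"
proof -
  let ?F = "free_proC C Y" and ?P = "free_prod C Y"
  let ?E = "{z \<in> carrier ?F. \<phi> z = \<psi> z}"
  have gF: "group ?F" and tF: "topspace (free_proC_top C Y) = carrier ?F"
    using free_proC_topological[OF C, of Y] by (auto simp: topological_group_def)
  have gP: "group ?P" by (rule free_prod_group[OF C])
  interpret p: group_hom ?F H \<phi> using gF H 1 by (simp add: group_hom_def group_hom_axioms_def)
  interpret q: group_hom ?F H \<psi> using gF H 2 by (simp add: group_hom_def group_hom_axioms_def)
  have "subgroup ?E ?F" by (rule subgroup.intro) auto
  then have "subgroup ?E (?P\<lparr>carrier := carrier ?F\<rparr>)" by (simp only: free_proC_eq[symmetric])
  then have sE: "subgroup ?E ?P" by (rule group.incl_subgroup[OF gP free_subgroup[OF C]])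
  have "closedin (free_proC_top C Y) {z \<in> topspace (free_proC_top C Y). \<phi> z = \<psi> z}"
    using TH 1(2) 2(2) by (rule closedin_continuous_maps_eq)
  then have "closedin (subtopology (free_prod_top C Y) (carrier ?F)) ?E"
    unfolding tF by (simp only: free_proC_top_def)
  then have cE: "closedin (free_prod_top C Y) ?E" using free_closedin[OF C] by (rule closedin_trans_full)
  have "closed_span ?P (free_prod_top C Y) (free_gen C Y ` topspace Y) \<subseteq> ?E"
    by (rule closed_span_least[OF sE cE]) (use eq free_gen_in_free[OF C] in auto)
  then show ?thesis using z by (auto simp: free_proC_def)
qed

lemma free_lift_exists:
  assumes C: "closed_class C" and H: "proC_group C H TH" and f: "continuous_map Y TH f"
  shows "\<exists>\<phi>. \<phi> \<in> extensional (carrier (free_proC C Y)) \<and>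
     \<phi> \<in> hom (free_proC C Y) H \<and> continuous_map (free_proC_top C Y) TH \<phi> \<and>
     (\<forall>y\<in>topspace Y. \<phi> (free_gen C Y y) = f y)"
proof -
  let ?F = "free_proC C Y" and ?P = "free_prod C Y" and ?PT = "free_prod_top C Y"
  have tgH: "topological_group H TH" and cH: "compact_space TH" and hH: "Hausdorff_space TH"
    and base: "\<And>U. openin TH U \<Longrightarrow> \<one>\<^bsub>H\<^esub> \<in> U \<Longrightarrow> \<exists>N. N \<lhd> H \<and> openin TH N \<and> N \<subseteq> U \<and> in_class C (H Mod N)"
    using H by (auto simp: proC_group_def)
  have gH: "group H" and tH: "topspace TH = carrier H"
    and mH: "continuous_map (prod_topology TH TH) TH (\<lambda>(x, y). x \<otimes>\<^bsub>H\<^esub> y)"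
    using tgH by (auto simp: topological_group_def)
  interpret H: group H by (rule gH)
  have gF: "group ?F" and tF: "topspace (free_proC_top C Y) = carrier ?F"
    using free_proC_topological[OF C, of Y] by (auto simp: topological_group_def)
  have gP: "group ?P" by (rule free_prod_group[OF C])
  have tP: "topspace ?PT = carrier ?P" using free_prod_topological[OF C, of Y] by (simp add: topological_group_def)
  have FP: "carrier ?F \<subseteq> carrier ?P" using free_subgroup[OF C] subgroup.subset by blast
  have FPm: "x \<otimes>\<^bsub>?F\<^esub> y = x \<otimes>\<^bsub>?P\<^esub> y" for x y by (simp add: free_proC_def)
  define NN where "NN = {N. N \<lhd> H \<and> openin TH N \<and> in_class C (H Mod N)}"
  have "\<forall>N\<in>NN. \<exists>Q e. Q \<in> C \<and> e \<in> iso (H Mod N) Q"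
    unfolding NN_def in_class_def is_iso_def by blast
  then obtain q e where q: "\<And>N. N \<in> NN \<Longrightarrow> q N \<in> C" and e: "\<And>N. N \<in> NN \<Longrightarrow> e N \<in> iso (H Mod N) (q N)"
    by metis
  define c where "c = (\<lambda>N h. e N (N #>\<^bsub>H\<^esub> h))"
  have NNn: "N \<lhd> H" and NNo: "openin TH N" if "N \<in> NN" for N using that by (auto simp: NN_def)
  have qg: "group (q N)" if "N \<in> NN" for N using C q[OF that] by (simp add: closed_class_def)
  have chom: "c N \<in> hom H (q N)" if "N \<in> NN" for N
  proof -
    have "e N \<circ> (\<lambda>a. N #>\<^bsub>H\<^esub> a) \<in> hom H (q N)"
      using hom_compose[OF normal.r_coset_hom_Mod[OF NNn[OF that]]] e[OF that] by (auto simp: iso_def)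
    then show ?thesis by (simp add: c_def o_def)
  qed
  have cinj: "a \<otimes>\<^bsub>H\<^esub> inv\<^bsub>H\<^esub> b \<in> N" if N: "N \<in> NN" and ab: "a \<in> carrier H" "b \<in> carrier H" and eq: "c N a = c N b" for N a b
  proof -
    have "inj_on (e N) (carrier (H Mod N))" using e[OF N] by (auto simp: iso_def bij_betw_def)
    then have "N #>\<^bsub>H\<^esub> a = N #>\<^bsub>H\<^esub> b"
      using eq ab unfolding c_def carrier_FactGroup by (auto dest: inj_onD)
    moreover have sN: "subgroup N H" using NNn[OF N] normal_imp_subgroup by blast
    ultimately have "a \<in> N #>\<^bsub>H\<^esub> b" using H.rcos_self[OF ab(1) sN] by simp
    then show ?thesis using subgroup.rcos_module_imp[OF sN gH ab(2)] by blast
  qed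
  have transl: "openin TH {h \<in> carrier H. h \<otimes>\<^bsub>H\<^esub> b \<in> U}" if "openin TH U" "b \<in> carrier H" for U b
  proof -
    have "continuous_map TH (prod_topology TH TH) (\<lambda>h. (h, b))"
      using that tH by (simp add: continuous_map_paired)
    then have "continuous_map TH TH ((\<lambda>(x, y). x \<otimes>\<^bsub>H\<^esub> y) \<circ> (\<lambda>h. (h, b)))"
      using mH by (rule continuous_map_compose)
    then have "openin TH {h \<in> topspace TH. ((\<lambda>(x, y). x \<otimes>\<^bsub>H\<^esub> y) \<circ> (\<lambda>h. (h, b))) h \<in> U}"
      using that(1) by (rule openin_continuous_map_preimage)
    then show ?thesis by (simp add: tH)
  qed
  have ccont: "continuous_map TH (discrete_topology (carrier (q N))) (c N)" if N: "N \<in> NN" for N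
    unfolding continuous_map_def
  proof (intro conjI allI impI)
    show "c N \<in> topspace TH \<rightarrow> topspace (discrete_topology (carrier (q N)))"
      using chom[OF N] tH by (auto simp: hom_def)
    fix U assume "openin (discrete_topology (carrier (q N))) U"
    show "openin TH {x \<in> topspace TH. c N x \<in> U}"
    proof (subst openin_subopen, intro ballI)
      fix x assume x: "x \<in> {x \<in> topspace TH. c N x \<in> U}"
      then have xc: "x \<in> carrier H" by (simp add: tH)
      have sN: "subgroup N H" using NNn[OF N] normal_imp_subgroup by blast
      let ?V = "{h \<in> carrier H. h \<otimes>\<^bsub>H\<^esub> inv\<^bsub>H\<^esub> x \<in> N}"
      have V1: "openin TH ?V" by (rule transl[OF NNo[OF N]]) (use xc in simp)
      have V2: "x \<in> ?V" using xc sN subgroup.one_closed by simp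
      have V3: "c N h = c N x" if "h \<in> ?V" for h
      proof -
        have "h \<in> N #>\<^bsub>H\<^esub> x" using that xc subgroup.rcos_module_rev[OF sN gH] by blast
        then show ?thesis unfolding c_def using H.repr_independence[OF _ xc sN] by metis
      qed
      have "?V \<subseteq> {x \<in> topspace TH. c N x \<in> U}"
      proof
        fix h assume h: "h \<in> ?V"
        have "c N x \<in> U" using x by blast
        then have "c N h \<in> U" by (subst V3[OF h])
        moreover have "h \<in> topspace TH" using h unfolding tH by blast
        ultimately show "h \<in> {x \<in> topspace TH. c N x \<in> U}" by blast
      qed
      then show "\<exists>T. openin TH T \<and> x \<in> T \<and> T \<subseteq> {x \<in> topspace TH. c N x \<in> U}"
        using V1 V2 by blast
    qed
  qed
  define j where "j = (\<lambda>N. (q N, \<lambda>y. c N (f y)))"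
  have jI: "j N \<in> free_index C Y" if "N \<in> NN" for N
    using q[OF that] continuous_map_compose[OF f ccont[OF that]]
    by (simp only: free_index_def j_def mem_Collect_eq prod.case o_def)
  define K where "K = {w \<in> topspace (prod_topology ?PT TH). \<forall>N\<in>NN. fst w (j N) = c N (snd w)}"
  obtain N0 where N0: "N0 \<in> NN" using base[of "carrier H"] tH by (auto simp: NN_def) (metis openin_topspace)
  have Kcl: "closedin (prod_topology ?PT TH) K"
  proof -
    have "closedin (prod_topology ?PT TH) {w \<in> topspace (prod_topology ?PT TH). fst w (j N) = c N (snd w)}"
      if N: "N \<in> NN" for N
    proof (rule closedin_continuous_maps_eq)
      show "Hausdorff_space (discrete_topology (carrier (q N)))" by simp
      have "continuous_map ?PT (discrete_topology (carrier (fst (j N)))) (\<lambda>x. x (j N))"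
        unfolding free_prod_top_def using jI[OF N] by (rule continuous_map_product_projection)
      then have "continuous_map ?PT (discrete_topology (carrier (q N))) (\<lambda>x. x (j N))" by (simp add: j_def)
      from continuous_map_compose[OF continuous_map_fst this]
      show "continuous_map (prod_topology ?PT TH) (discrete_topology (carrier (q N))) (\<lambda>w. fst w (j N))"
        by (simp add: o_def)
      from continuous_map_compose[OF continuous_map_snd ccont[OF N]]
      show "continuous_map (prod_topology ?PT TH) (discrete_topology (carrier (q N))) (\<lambda>w. c N (snd w))"
        by (simp add: o_def)
    qed
    then have "closedin (prod_topology ?PT TH) (\<Inter>N\<in>NN. {w \<in> topspace (prod_topology ?PT TH). fst w (j N) = c N (snd w)})"
      using N0 by (intro closedin_INT) auto
    moreover have "K = (\<Inter>N\<in>NN. {w \<in> topspace (prod_topology ?PT TH). fst w (j N) = c N (snd w)})"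
      using N0 by (auto simp: K_def)
    ultimately show ?thesis by simp
  qed
  have fstcl: "closedin ?PT (fst ` K)" using closed_map_fst[OF cH] Kcl by (auto simp: closed_map_def)
  have KI: "(z, h) \<in> K \<longleftrightarrow> z \<in> carrier ?P \<and> h \<in> carrier H \<and> (\<forall>N\<in>NN. z (j N) = c N h)" for z h
    by (auto simp: K_def tP tH)
  have Kone: "(\<one>\<^bsub>?P\<^esub>, \<one>\<^bsub>H\<^esub>) \<in> K"
  proof -
    have "\<one>\<^bsub>?P\<^esub> (j N) = c N \<one>\<^bsub>H\<^esub>" if "N \<in> NN" for N
      using jI[OF that] hom_one[OF chom[OF that] gH qg[OF that]] by (simp add: free_prod_def j_def)
    then show ?thesis using gP gH by (simp add: KI group.is_monoid)
  qed
  have Kmult: "(z \<otimes>\<^bsub>?P\<^esub> z', h \<otimes>\<^bsub>H\<^esub> h') \<in> K" if "(z, h) \<in> K" "(z', h') \<in> K" for z h z' h'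
  proof -
    have "(z \<otimes>\<^bsub>?P\<^esub> z') (j N) = c N (h \<otimes>\<^bsub>H\<^esub> h')" if N: "N \<in> NN" for N
    proof -
      have "(z \<otimes>\<^bsub>?P\<^esub> z') (j N) = z (j N) \<otimes>\<^bsub>q N\<^esub> z' (j N)"
        using jI[OF N] by (simp add: free_prod_def j_def)
      also have "\<dots> = c N (h \<otimes>\<^bsub>H\<^esub> h')"
        using \<open>(z, h) \<in> K\<close> \<open>(z', h') \<in> K\<close> N hom_mult[OF chom[OF N]] by (simp add: KI)
      finally show ?thesis .
    qed
    then show ?thesis using that gP gH monoid.m_closed[OF group.is_monoid[OF gP]] by (simp add: KI)
  qed
  have Kinv: "(inv\<^bsub>?P\<^esub> z, inv\<^bsub>H\<^esub> h) \<in> K" if zh: "(z, h) \<in> K" for z h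
  proof -
    have zc: "z \<in> carrier ?P" and hc: "h \<in> carrier H" using zh by (auto simp: KI)
    have "(inv\<^bsub>?P\<^esub> z) (j N) = c N (inv\<^bsub>H\<^esub> h)" if N: "N \<in> NN" for N
    proof -
      have g: "\<And>i. i \<in> free_index C Y \<Longrightarrow> group (fst i)" using C by (auto simp: free_index_def closed_class_def)
      have "(inv\<^bsub>?P\<^esub> z) = (\<lambda>i\<in>free_index C Y. inv\<^bsub>fst i\<^esub> (z i))"
        using zc g unfolding free_prod_def by (intro inv_product_group) auto
      then have "(inv\<^bsub>?P\<^esub> z) (j N) = inv\<^bsub>q N\<^esub> (z (j N))" using jI[OF N] by (simp add: j_def)
      also have "z (j N) = c N h" using zh N by (simp add: KI)
      also have "inv\<^bsub>q N\<^esub> (c N h) = c N (inv\<^bsub>H\<^esub> h)"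
        using group_hom.hom_inv[of H "q N" "c N" h] gH qg[OF N] chom[OF N] hc
        by (simp add: group_hom_def group_hom_axioms_def)
      finally show ?thesis .
    qed
    then show ?thesis using zc hc gP by (simp add: KI)
  qed
  have Kgen: "(free_gen C Y y, f y) \<in> K" if y: "y \<in> topspace Y" for y
  proof -
    have "free_gen C Y y (j N) = c N (f y)" if "N \<in> NN" for N
      using jI[OF that] by (simp add: free_gen_def j_def)
    moreover have "f y \<in> carrier H" using f y tH continuous_map_image_subset_topspace by blast
    ultimately show ?thesis using free_gen_in_free[OF C y] FP by (auto simp: KI)
  qed
  have Ksub: "subgroup (fst ` K) ?P"
  proof (rule group.subgroupI[OF gP])
    show "fst ` K \<subseteq> carrier ?P" by (auto simp: KI)
    show "fst ` K \<noteq> {}" using Kone by blast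
    show "inv\<^bsub>?P\<^esub> a \<in> fst ` K" if "a \<in> fst ` K" for a using that Kinv by force
    show "a \<otimes>\<^bsub>?P\<^esub> b \<in> fst ` K" if "a \<in> fst ` K" "b \<in> fst ` K" for a b using that Kmult by force
  qed
  have "closed_span ?P ?PT (free_gen C Y ` topspace Y) \<subseteq> fst ` K"
    by (rule closed_span_least[OF Ksub fstcl]) (use Kgen in force)
  then have ex: "\<exists>h. (z, h) \<in> K" if "z \<in> carrier ?F" for z
    using that by (force simp: free_proC_def)
  have uniq: "h = h'" if a: "(z, h) \<in> K" "(z, h') \<in> K" for z h h'
  proof (rule ccontr)
    assume ne: "h \<noteq> h'"
    have hc: "h \<in> carrier H" "h' \<in> carrier H" using a by (auto simp: KI)
    let ?d = "h \<otimes>\<^bsub>H\<^esub> inv\<^bsub>H\<^esub> h'"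
    have d1: "?d \<in> carrier H" using hc by simp
    have d2: "?d \<noteq> \<one>\<^bsub>H\<^esub>"
    proof
      assume "?d = \<one>\<^bsub>H\<^esub>"
      then have "h = \<one>\<^bsub>H\<^esub> \<otimes>\<^bsub>H\<^esub> h'" using H.inv_solve_right[of "\<one>\<^bsub>H\<^esub>" h h'] hc by simp
      then show False using hc ne by simp
    qed
    note d = d1 d2
    have "closedin TH {?d}" using closedin_Hausdorff_sing_eq[OF hH] d1 tH by metis
    then have "openin TH (carrier H - {?d})" using tH by (simp add: closedin_def)
    then obtain N where N: "N \<lhd> H" "openin TH N" "N \<subseteq> carrier H - {?d}" "in_class C (H Mod N)"
      using base[of "carrier H - {?d}"] d by auto
    then have NN: "N \<in> NN" by (simp add: NN_def)
    have "c N h = c N h'" using a NN unfolding KI by (metis (no_types))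
    then have "?d \<in> N" using cinj[OF NN hc] by simp
    then show False using N by blast
  qed
  define \<phi> where "\<phi> = restrict (\<lambda>z. THE h. (z, h) \<in> K) (carrier ?F)"
  have phiK: "(z, \<phi> z) \<in> K" if "z \<in> carrier ?F" for z
  proof -
    have "\<exists>!h. (z, h) \<in> K" using ex[OF that] uniq by blast
    then show ?thesis using that theI'[of "\<lambda>h. (z, h) \<in> K"] by (simp add: \<phi>_def)
  qed
  have phi_eq: "\<phi> z = h" if "z \<in> carrier ?F" "(z, h) \<in> K" for z h
    using uniq phiK that by blast
  have hom: "\<phi> \<in> hom ?F H"
  proof (rule homI)
    fix x assume "x \<in> carrier ?F" then show "\<phi> x \<in> carrier H" using phiK by (auto simp: KI)
  next
    fix x y assume xy: "x \<in> carrier ?F" "y \<in> carrier ?F"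
    have "x \<otimes>\<^bsub>?F\<^esub> y \<in> carrier ?F" using xy gF by (simp add: group.is_monoid monoid.m_closed)
    then show "\<phi> (x \<otimes>\<^bsub>?F\<^esub> y) = \<phi> x \<otimes>\<^bsub>H\<^esub> \<phi> y"
      by (rule phi_eq) (use xy phiK Kmult in \<open>simp add: FPm\<close>)
  qed
  have cont: "continuous_map (free_proC_top C Y) TH \<phi>"
    unfolding continuous_map_def
  proof (intro conjI allI impI)
    show "\<phi> \<in> topspace (free_proC_top C Y) \<rightarrow> topspace TH" using hom by (auto simp: tF tH hom_def)
    fix U assume U: "openin TH U"
    show "openin (free_proC_top C Y) {x \<in> topspace (free_proC_top C Y). \<phi> x \<in> U}"
    proof (subst openin_subopen, intro ballI)
      fix z assume "z \<in> {x \<in> topspace (free_proC_top C Y). \<phi> x \<in> U}"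
      then have z: "z \<in> carrier ?F" "\<phi> z \<in> U" by (auto simp: tF)
      have pz: "\<phi> z \<in> carrier H" using hom z by (auto simp: hom_def)
      have "openin TH {h \<in> carrier H. h \<otimes>\<^bsub>H\<^esub> \<phi> z \<in> U}" by (rule transl[OF U pz])
      then obtain N where N: "N \<lhd> H" "openin TH N" "N \<subseteq> {h \<in> carrier H. h \<otimes>\<^bsub>H\<^esub> \<phi> z \<in> U}" "in_class C (H Mod N)"
        using base[of "{h \<in> carrier H. h \<otimes>\<^bsub>H\<^esub> \<phi> z \<in> U}"] z pz by auto
      then have NN: "N \<in> NN" by (simp add: NN_def)
      let ?V = "{w \<in> topspace ?PT. w (j N) \<in> {z (j N)}} \<inter> carrier ?F"
      have "continuous_map ?PT (discrete_topology (carrier (fst (j N)))) (\<lambda>x. x (j N))"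
        unfolding free_prod_top_def using jI[OF NN] by (rule continuous_map_product_projection)
      moreover have "z (j N) \<in> carrier (fst (j N))"
        using z FP jI[OF NN] by (auto simp: free_prod_def)
      ultimately have "openin ?PT {w \<in> topspace ?PT. w (j N) \<in> {z (j N)}}"
        by (intro openin_continuous_map_preimage) auto
      then have V1: "openin (free_proC_top C Y) ?V" unfolding free_proC_top_def openin_subtopology by blast
      have V2: "z \<in> ?V" using z FP tP by auto
      have V3: "\<phi> w \<in> U" if w: "w \<in> ?V" for w
      proof -
        have wF: "w \<in> carrier ?F" and pw: "\<phi> w \<in> carrier H" using w hom by (auto simp: hom_def)
        have "c N (\<phi> w) = w (j N)" "c N (\<phi> z) = z (j N)" using phiK[OF wF] phiK[OF z(1)] NN by (auto simp: KI)
        then have "c N (\<phi> w) = c N (\<phi> z)" using w by simp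
        then have "\<phi> w \<otimes>\<^bsub>H\<^esub> inv\<^bsub>H\<^esub> \<phi> z \<in> N" by (rule cinj[OF NN pw pz])
        then have "\<phi> w \<otimes>\<^bsub>H\<^esub> inv\<^bsub>H\<^esub> \<phi> z \<otimes>\<^bsub>H\<^esub> \<phi> z \<in> U" using N(3) by blast
        then show ?thesis using pw pz by (simp add: H.m_assoc)
      qed
      have "?V \<subseteq> {x \<in> topspace (free_proC_top C Y). \<phi> x \<in> U}"
      proof
        fix w assume w: "w \<in> ?V"
        then have "w \<in> topspace (free_proC_top C Y)" unfolding tF by blast
        then show "w \<in> {x \<in> topspace (free_proC_top C Y). \<phi> x \<in> U}" using V3[OF w] by blast
      qed
      then show "\<exists>T. openin (free_proC_top C Y) T \<and> z \<in> T \<and> T \<subseteq> {x \<in> topspace (free_proC_top C Y). \<phi> x \<in> U}"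
        using V1 V2 by blast
    qed
  qed
  have gen: "\<phi> (free_gen C Y y) = f y" if "y \<in> topspace Y" for y
    by (rule phi_eq[OF free_gen_in_free[OF C that] Kgen[OF that]])
  show ?thesis using hom cont gen by (intro exI[of _ \<phi>]) (auto simp: \<phi>_def)
qed

theorem free_proC_universal:
  assumes C: "closed_class C" and H: "proC_group C H TH" and f: "continuous_map Y TH f"
  shows "\<exists>!\<phi>. \<phi> \<in> extensional (carrier (free_proC C Y)) \<and>
     \<phi> \<in> hom (free_proC C Y) H \<and> continuous_map (free_proC_top C Y) TH \<phi> \<and>
     (\<forall>y\<in>topspace Y. \<phi> (free_gen C Y y) = f y)"
proof -
  have g: "group H" "Hausdorff_space TH" using H by (auto simp: proC_group_def topological_group_def)
  show ?thesis
  proof (rule ex_ex1I)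
    fix \<phi> \<psi>
    assume 1: "\<phi> \<in> extensional (carrier (free_proC C Y)) \<and> \<phi> \<in> hom (free_proC C Y) H \<and>
        continuous_map (free_proC_top C Y) TH \<phi> \<and> (\<forall>y\<in>topspace Y. \<phi> (free_gen C Y y) = f y)"
      and 2: "\<psi> \<in> extensional (carrier (free_proC C Y)) \<and> \<psi> \<in> hom (free_proC C Y) H \<and>
        continuous_map (free_proC_top C Y) TH \<psi> \<and> (\<forall>y\<in>topspace Y. \<psi> (free_gen C Y y) = f y)"
    have eq: "\<phi> z = \<psi> z" if "z \<in> carrier (free_proC C Y)" for z
      by (rule free_lift_unique[OF C g _ _ _ _ _ that]) (use 1 2 in simp_all)
    show "\<phi> = \<psi>"
      by (rule extensionalityI[of \<phi> "carrier (free_proC C Y)"]) (use 1 2 eq in simp_all)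
  qed (rule free_lift_exists[OF assms])
qed

lemma free_lift_props:
  assumes "closed_class C" "proC_group C H TH" "continuous_map Y TH f"
  shows "free_lift C Y H TH f \<in> hom (free_proC C Y) H"
    and "continuous_map (free_proC_top C Y) TH (free_lift C Y H TH f)"
    and "y \<in> topspace Y \<Longrightarrow> free_lift C Y H TH f (free_gen C Y y) = f y"
proof -
  have *: "free_lift C Y H TH f \<in> extensional (carrier (free_proC C Y)) \<and>
     free_lift C Y H TH f \<in> hom (free_proC C Y) H \<and>
     continuous_map (free_proC_top C Y) TH (free_lift C Y H TH f) \<and>
     (\<forall>y\<in>topspace Y. free_lift C Y H TH f (free_gen C Y y) = f y)"
    unfolding free_lift_def by (rule theI'[OF free_proC_universal[OF assms]])
  show "free_lift C Y H TH f \<in> hom (free_proC C Y) H" using * by simp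
  show "continuous_map (free_proC_top C Y) TH (free_lift C Y H TH f)" using * by simp
  show "y \<in> topspace Y \<Longrightarrow> free_lift C Y H TH f (free_gen C Y y) = f y" using * by simp
qed

lemma in_class_iso: "in_class C G \<Longrightarrow> G' \<cong> G \<Longrightarrow> in_class C G'"
  unfolding in_class_def using iso_trans by blast

lemma in_class_subgroup:
  assumes C: "closed_class C" and G: "group G" "in_class C G" and K: "subgroup K G"
  shows "in_class C (G\<lparr>carrier := K\<rparr>)"
proof -
  obtain Q f where Q: "Q \<in> C" and f: "f \<in> iso G Q" using G by (auto simp: in_class_def is_iso_def)
  have gQ: "group Q" using C Q by (simp add: closed_class_def)
  have "group_hom G Q f" using f G gQ by (simp add: group_hom_def group_hom_axioms_def iso_def)
  then have "subgroup (f ` K) Q" using K by (rule group_hom.subgroup_img_is_subgroup)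
  then have "in_class C (Q\<lparr>carrier := f ` K\<rparr>)" using C Q unfolding closed_class_def by blast
  moreover have "G\<lparr>carrier := K\<rparr> \<cong> Q\<lparr>carrier := f ` K\<rparr>"
    using iso_restrict[OF f G(1) gQ K] by (rule is_isoI)
  ultimately show ?thesis by (rule in_class_iso)
qed

lemma in_class_DirProd:
  assumes C: "closed_class C" and G: "group G" "in_class C G" and H: "in_class C H"
  shows "in_class C (G \<times>\<times> H)"
proof -
  obtain Q Q' where Q: "Q \<in> C" "G \<cong> Q" "Q' \<in> C" "H \<cong> Q'" using G H by (auto simp: in_class_def)
  have "in_class C (Q \<times>\<times> Q')" using C Q unfolding closed_class_def by blast
  moreover have "G \<times>\<times> H \<cong> Q \<times>\<times> Q'" using group.DirProd_iso_trans[OF G(1)] Q by blast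
  ultimately show ?thesis by (rule in_class_iso)
qed

lemma in_class_product:
  assumes C: "closed_class C" "C \<noteq> {}" and J: "finite J" "\<And>i. i \<in> J \<Longrightarrow> G i \<in> C"
  shows "in_class C (product_group J G)"
  using J
proof (induction J rule: finite_induct)
  case empty
  obtain Q where Q: "Q \<in> C" using C by blast
  interpret group Q using C Q by (simp add: closed_class_def)
  have "in_class C (Q\<lparr>carrier := {\<one>\<^bsub>Q\<^esub>}\<rparr>)" using C Q triv_subgroup unfolding closed_class_def by blast
  moreover have "(\<lambda>x. \<one>\<^bsub>Q\<^esub>) \<in> iso (product_group {} G) (Q\<lparr>carrier := {\<one>\<^bsub>Q\<^esub>}\<rparr>)"
    by (auto simp: iso_def hom_def bij_betw_def)
  ultimately show ?case using in_class_iso is_isoI by blast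
next
  case (insert i J)
  have gi: "group (G i)" "\<And>k. k \<in> J \<Longrightarrow> group (G k)" using C insert.prems by (auto simp: closed_class_def)
  have "in_class C (G i)" using insert.prems by (auto simp: in_class_def intro!: bexI[of _ "G i"] iso_refl)
  then have 1: "in_class C (G i \<times>\<times> product_group J G)"
    using in_class_DirProd[OF C(1) gi(1)] insert by simp
  have "(\<lambda>x. (x i, restrict x J)) \<in> iso (product_group (insert i J) G) (G i \<times>\<times> product_group J G)"
  proof (rule isoI)
    show "(\<lambda>x. (x i, restrict x J)) \<in> hom (product_group (insert i J) G) (G i \<times>\<times> product_group J G)"
      by (rule homI) (auto simp: fun_eq_iff)
    show "bij_betw (\<lambda>x. (x i, restrict x J)) (carrier (product_group (insert i J) G)) (carrier (G i \<times>\<times> product_group J G))"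
    proof (rule bij_betwI[where g = "\<lambda>(a, y). \<lambda>k\<in>insert i J. if k = i then a else y k"])
      show "(\<lambda>x. (x i, restrict x J)) \<in> carrier (product_group (insert i J) G) \<rightarrow> carrier (G i \<times>\<times> product_group J G)"
        by auto
      show "(\<lambda>(a, y). \<lambda>k\<in>insert i J. if k = i then a else y k) \<in> carrier (G i \<times>\<times> product_group J G) \<rightarrow> carrier (product_group (insert i J) G)"
        by (rule funcsetI) (auto simp: PiE_iff extensional_def restrict_def split: if_splits)
    next
      fix x assume x: "x \<in> carrier (product_group (insert i J) G)"
      show "(case (x i, restrict x J) of (a, y) \<Rightarrow> \<lambda>k\<in>insert i J. if k = i then a else y k) = x"
      proof
        fix k show "(case (x i, restrict x J) of (a, y) \<Rightarrow> \<lambda>k\<in>insert i J. if k = i then a else y k) k = x k"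
          using x by (cases "k \<in> insert i J") (auto simp: PiE_def extensional_def)
      qed
    next
      fix p assume p: "p \<in> carrier (G i \<times>\<times> product_group J G)"
      obtain a y where [simp]: "p = (a, y)" by (cases p)
      have "y \<in> extensional J" using p by (auto simp: PiE_def)
      then have "restrict (\<lambda>k\<in>insert i J. if k = i then a else y k) J = y"
        using insert.hyps by (auto simp: fun_eq_iff extensional_def restrict_def)
      then show "((case p of (a, y) \<Rightarrow> \<lambda>k\<in>insert i J. if k = i then a else y k) i,
             restrict (case p of (a, y) \<Rightarrow> \<lambda>k\<in>insert i J. if k = i then a else y k) J) = p"
        by simp
    qed
  qed
  then show ?case using 1 in_class_iso is_isoI by blast
qed

theorem free_proC_is_proC_group:
  assumes C: "closed_class C" "C \<noteq> {}"
  shows "proC_group C (free_proC C Y) (free_proC_top C Y)"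
  unfolding proC_group_def
proof (intro conjI allI impI)
  let ?F = "free_proC C Y" and ?P = "free_prod C Y" and ?PT = "free_prod_top C Y" and ?I = "free_index C Y"
  show "topological_group ?F (free_proC_top C Y)" by (rule free_proC_topological[OF C(1)])
  show "compact_space (free_proC_top C Y)" by (rule free_proC_compact[OF C(1)])
  show "Hausdorff_space (free_proC_top C Y)" by (rule free_proC_Hausdorff)
  fix U assume U: "openin (free_proC_top C Y) U \<and> \<one>\<^bsub>?F\<^esub> \<in> U"
  have gF: "group ?F" and tF: "topspace (free_proC_top C Y) = carrier ?F"
    using free_proC_topological[OF C(1), of Y] by (auto simp: topological_group_def)
  have FP: "carrier ?F \<subseteq> carrier ?P" using free_subgroup[OF C(1)] subgroup.subset by blast
  have P1: "\<one>\<^bsub>?F\<^esub> = (\<lambda>i\<in>?I. \<one>\<^bsub>fst i\<^esub>)" by (simp add: free_proC_def free_prod_def)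
  have Pm: "x \<otimes>\<^bsub>?F\<^esub> y = (\<lambda>i\<in>?I. x i \<otimes>\<^bsub>fst i\<^esub> y i)" for x y by (simp add: free_proC_def free_prod_def)
  obtain V where V: "openin ?PT V" "U = V \<inter> carrier ?F"
    using U unfolding free_proC_top_def openin_subtopology by blast
  then have "\<one>\<^bsub>?F\<^esub> \<in> V" using U by blast
  then obtain W where W: "finite {i \<in> ?I. W i \<noteq> topspace (discrete_topology (carrier (fst i)))}"
      "\<one>\<^bsub>?F\<^esub> \<in> Pi\<^sub>E ?I W" "Pi\<^sub>E ?I W \<subseteq> V"
    using V(1) unfolding free_prod_top_def openin_product_topology_alt by meson
  define J where "J = {i \<in> ?I. W i \<noteq> carrier (fst i)}"
  have J: "finite J" "J \<subseteq> ?I" using W(1) by (auto simp: J_def)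
  have JC: "fst i \<in> C" if "i \<in> J" for i using that J by (auto simp: free_index_def)
  let ?Q = "product_group J fst"
  let ?r = "\<lambda>z. restrict z J"
  have gi: "group (fst i)" if "i \<in> J" for i using JC[OF that] C(1) by (simp add: closed_class_def)
  have gQ: "group ?Q" by (rule product_group) (rule gi)
  have rh: "?r \<in> hom ?F ?Q"
  proof (rule homI)
    fix x assume "x \<in> carrier ?F"
    then have "x \<in> (\<Pi>\<^sub>E i\<in>?I. carrier (fst i))" using FP by (auto simp: free_prod_def)
    then show "?r x \<in> carrier ?Q" using J by auto
  next
    fix x y show "?r (x \<otimes>\<^bsub>?F\<^esub> y) = ?r x \<otimes>\<^bsub>?Q\<^esub> ?r y" using J by (auto simp: Pm fun_eq_iff)
  qed
  interpret r: group_hom ?F ?Q ?r using gF gQ rh by (simp add: group_hom_def group_hom_axioms_def)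
  let ?N = "kernel ?F ?Q ?r"
  have Ni: "z \<in> ?N \<longleftrightarrow> z \<in> carrier ?F \<and> (\<forall>i\<in>J. z i = \<one>\<^bsub>fst i\<^esub>)" for z
  proof -
    have "?r z = (\<lambda>i\<in>J. \<one>\<^bsub>fst i\<^esub>) \<longleftrightarrow> (\<forall>i\<in>J. z i = \<one>\<^bsub>fst i\<^esub>)"
      by (auto simp: restrict_def fun_eq_iff)
    then show ?thesis by (simp add: kernel_def)
  qed
  have nN: "?N \<lhd> ?F" by (rule r.normal_kernel)
  have oN: "openin (free_proC_top C Y) ?N"
  proof -
    have "openin ?PT (Pi\<^sub>E ?I (\<lambda>i. if i \<in> J then {\<one>\<^bsub>fst i\<^esub>} else carrier (fst i)))"
    proof -
      have "finite {i \<in> ?I. (if i \<in> J then {\<one>\<^bsub>fst i\<^esub>} else carrier (fst i)) \<noteq> topspace (discrete_topology (carrier (fst i)))}"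
        by (rule finite_subset[OF _ J(1)]) auto
      moreover have "openin (discrete_topology (carrier (fst i))) (if i \<in> J then {\<one>\<^bsub>fst i\<^esub>} else carrier (fst i))" for i
        using gi[of i] by (auto simp: group.is_monoid)
      ultimately show ?thesis unfolding free_prod_top_def by (subst openin_PiE_gen) auto
    qed
    moreover have "?N = Pi\<^sub>E ?I (\<lambda>i. if i \<in> J then {\<one>\<^bsub>fst i\<^esub>} else carrier (fst i)) \<inter> carrier ?F"
    proof (intro Set.set_eqI iffI)
      fix z assume z: "z \<in> ?N"
      then have "z \<in> (\<Pi>\<^sub>E i\<in>?I. carrier (fst i))" using FP Ni by (auto simp: free_prod_def)
      then have zE: "z \<in> extensional ?I" and zc: "\<And>i. i \<in> ?I \<Longrightarrow> z i \<in> carrier (fst i)"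
        by (simp_all add: PiE_iff)
      have zN: "z \<in> carrier ?F" "\<And>i. i \<in> J \<Longrightarrow> z i = \<one>\<^bsub>fst i\<^esub>" using z unfolding Ni by simp_all
      show "z \<in> Pi\<^sub>E ?I (\<lambda>i. if i \<in> J then {\<one>\<^bsub>fst i\<^esub>} else carrier (fst i)) \<inter> carrier ?F"
        using zE zc zN by (simp add: PiE_iff)
    next
      fix z assume z: "z \<in> Pi\<^sub>E ?I (\<lambda>i. if i \<in> J then {\<one>\<^bsub>fst i\<^esub>} else carrier (fst i)) \<inter> carrier ?F"
      have "z i = \<one>\<^bsub>fst i\<^esub>" if "i \<in> J" for i
      proof -
        have "z i \<in> (if i \<in> J then {\<one>\<^bsub>fst i\<^esub>} else carrier (fst i))"
          using z that J(2) by (intro PiE_mem[of z ?I]) (rule IntD1, assumption, blast)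
        then show ?thesis using that by simp
      qed
      then show "z \<in> ?N" using z by (simp add: Ni)
    qed
    ultimately show ?thesis unfolding free_proC_top_def openin_subtopology by blast
  qed
  have NU: "?N \<subseteq> U"
  proof
    fix z assume z: "z \<in> ?N"
    then have zF: "z \<in> carrier ?F" and z1: "\<And>i. i \<in> J \<Longrightarrow> z i = \<one>\<^bsub>fst i\<^esub>" by (auto simp: Ni)
    have zP: "z \<in> (\<Pi>\<^sub>E i\<in>?I. carrier (fst i))" using zF FP by (auto simp: free_prod_def)
    have "z i \<in> W i" if i: "i \<in> ?I" for i
    proof (cases "i \<in> J")
      case True
      have "(\<lambda>i\<in>?I. \<one>\<^bsub>fst i\<^esub>) i \<in> W i" using W(2) i unfolding P1 by (rule PiE_mem)
      then show ?thesis using z1[OF True] i by simp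
    next
      case False
      then have "W i = carrier (fst i)" using i by (simp add: J_def)
      then show ?thesis using PiE_mem[OF zP i] by simp
    qed
    then have "z \<in> Pi\<^sub>E ?I W" using zP by (auto simp: PiE_def)
    then show "z \<in> U" using W(3) V(2) zF by blast
  qed
  have cN: "in_class C (?F Mod ?N)"
  proof -
    let ?K = "?r ` carrier ?F"
    have sK: "subgroup ?K ?Q" by (rule r.img_is_subgroup)
    have K1: "in_class C (?Q\<lparr>carrier := ?K\<rparr>)"
      by (rule in_class_subgroup[OF C(1) gQ in_class_product[OF C J(1) JC] sK])
    have "group_hom ?F (?Q\<lparr>carrier := ?K\<rparr>) ?r"
    proof -
      have "group (?Q\<lparr>carrier := ?K\<rparr>)" by (rule group.subgroup_imp_group[OF gQ sK])
      moreover have "?r \<in> hom ?F (?Q\<lparr>carrier := ?K\<rparr>)" using rh by (auto simp: hom_def)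
      ultimately show ?thesis using gF by (simp add: group_hom_def group_hom_axioms_def)
    qed
    then have 1: "?F Mod (kernel ?F (?Q\<lparr>carrier := ?K\<rparr>) ?r) \<cong> ?Q\<lparr>carrier := ?K\<rparr>"
      by (rule group_hom.FactGroup_iso) simp
    have 2: "kernel ?F (?Q\<lparr>carrier := ?K\<rparr>) ?r = ?N" by (simp add: kernel_def)
    show ?thesis by (rule in_class_iso[OF K1 1[unfolded 2]])
  qed
  show "\<exists>N. N \<lhd> ?F \<and> openin (free_proC_top C Y) N \<and> N \<subseteq> U \<and> in_class C (?F Mod N)"
    using nN oN NU cN by blast
qed


section \<open>Presentations and identities among the relations\<close>

definition proC_presentation ::
  "nat monoid set \<Rightarrow> 'x topology \<Rightarrow> 'r topology \<Rightarrow> ('r \<Rightarrow> 'x fpc) \<Rightarrow> ('g, 'm) monoid_scheme \<Rightarrow> 'g topology \<Rightarrow> bool" where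
  "proC_presentation C X R \<omega> G TG \<longleftrightarrow>
     profinite_space X \<and> profinite_space R \<and> proC_group C G TG \<and>
     continuous_map R (free_proC_top C X) \<omega> \<and>
     (\<exists>p. p \<in> hom (free_proC C X) G \<and> continuous_map (free_proC_top C X) TG p \<and>
        p ` carrier (free_proC C X) = carrier G \<and>
        kernel (free_proC C X) G p =
          closed_normal_span (free_proC C X) (free_proC_top C X) (\<omega> ` topspace R))"

abbreviation XR_grp :: "nat monoid set \<Rightarrow> 'x topology \<Rightarrow> 'r topology \<Rightarrow> ('x + 'r) fpc monoid" where
  "XR_grp C X R \<equiv> free_proC C (plus_topology X R)"

abbreviation XR_top :: "nat monoid set \<Rightarrow> 'x topology \<Rightarrow> 'r topology \<Rightarrow> ('x + 'r) fpc topology" where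
  "XR_top C X R \<equiv> free_proC_top C (plus_topology X R)"

definition XR_incl :: "nat monoid set \<Rightarrow> 'x topology \<Rightarrow> 'r topology \<Rightarrow> 'x fpc \<Rightarrow> ('x + 'r) fpc" where
  "XR_incl C X R = free_lift C X (XR_grp C X R) (XR_top C X R)
     (\<lambda>x. free_gen C (plus_topology X R) (Inl x))"

definition XR_theta ::
  "nat monoid set \<Rightarrow> 'x topology \<Rightarrow> 'r topology \<Rightarrow> ('r \<Rightarrow> 'x fpc) \<Rightarrow> ('x + 'r) fpc \<Rightarrow> 'x fpc" where
  "XR_theta C X R \<omega> = free_lift C (plus_topology X R) (free_proC C X) (free_proC_top C X)
     (case_sum (free_gen C X) \<omega>)"

definition rel_carrier :: "nat monoid set \<Rightarrow> 'x topology \<Rightarrow> 'r topology \<Rightarrow> ('x + 'r) fpc set" where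
  "rel_carrier C X R = closed_normal_span (XR_grp C X R) (XR_top C X R)
     ((\<lambda>\<rho>. free_gen C (plus_topology X R) (Inr \<rho>)) ` topspace R)"

definition rel_grp :: "nat monoid set \<Rightarrow> 'x topology \<Rightarrow> 'r topology \<Rightarrow> ('x + 'r) fpc monoid" where
  "rel_grp C X R = (XR_grp C X R)\<lparr>carrier := rel_carrier C X R\<rparr>"

definition rel_top :: "nat monoid set \<Rightarrow> 'x topology \<Rightarrow> 'r topology \<Rightarrow> ('x + 'r) fpc topology" where
  "rel_top C X R = subtopology (XR_top C X R) (rel_carrier C X R)"

definition conj_by :: "('a, 'm) monoid_scheme \<Rightarrow> 'a \<Rightarrow> 'a \<Rightarrow> 'a" where
  "conj_by G a h = a \<otimes>\<^bsub>G\<^esub> h \<otimes>\<^bsub>G\<^esub> inv\<^bsub>G\<^esub> a"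

definition rel_act ::
  "nat monoid set \<Rightarrow> 'x topology \<Rightarrow> 'r topology \<Rightarrow> 'x fpc \<Rightarrow> ('x + 'r) fpc \<Rightarrow> ('x + 'r) fpc" where
  "rel_act C X R u = conj_by (XR_grp C X R) (XR_incl C X R u)"

definition peiffer_comm ::
  "nat monoid set \<Rightarrow> 'x topology \<Rightarrow> 'r topology \<Rightarrow> ('r \<Rightarrow> 'x fpc) \<Rightarrow> ('x + 'r) fpc \<Rightarrow> ('x + 'r) fpc \<Rightarrow> ('x + 'r) fpc" where
  "peiffer_comm C X R \<omega> a b =
     conj_by (rel_grp C X R) a b
       \<otimes>\<^bsub>rel_grp C X R\<^esub> inv\<^bsub>rel_grp C X R\<^esub> (rel_act C X R (XR_theta C X R \<omega> a) b)"

definition peiffer_sub ::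
  "nat monoid set \<Rightarrow> 'x topology \<Rightarrow> 'r topology \<Rightarrow> ('r \<Rightarrow> 'x fpc) \<Rightarrow> ('x + 'r) fpc set" where
  "peiffer_sub C X R \<omega> = closed_span (rel_grp C X R) (rel_top C X R)
     {peiffer_comm C X R \<omega> a b | a b. a \<in> rel_carrier C X R \<and> b \<in> rel_carrier C X R}"

definition xmod_grp ::
  "nat monoid set \<Rightarrow> 'x topology \<Rightarrow> 'r topology \<Rightarrow> ('r \<Rightarrow> 'x fpc) \<Rightarrow> ('x + 'r) fpc set monoid" where
  "xmod_grp C X R \<omega> = rel_grp C X R Mod peiffer_sub C X R \<omega>"

definition xmod_top ::
  "nat monoid set \<Rightarrow> 'x topology \<Rightarrow> 'r topology \<Rightarrow> ('r \<Rightarrow> 'x fpc) \<Rightarrow> ('x + 'r) fpc set topology" where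
  "xmod_top C X R \<omega> = quotient_topology (rel_grp C X R) (rel_top C X R) (peiffer_sub C X R \<omega>)"

definition xmod_boundary ::
  "nat monoid set \<Rightarrow> 'x topology \<Rightarrow> 'r topology \<Rightarrow> ('r \<Rightarrow> 'x fpc) \<Rightarrow> ('x + 'r) fpc set \<Rightarrow> 'x fpc" where
  "xmod_boundary C X R \<omega> A = the_elem (XR_theta C X R \<omega> ` A)"

text \<open>The action of the free group on \<^term>\<open>X\<close> on the crossed module. Restricted to the kernel of the
  boundary it factors through G, which is what makes the identities a G-module.\<close>

definition xmod_act ::
  "nat monoid set \<Rightarrow> 'x topology \<Rightarrow> 'r topology \<Rightarrow> 'x fpc \<Rightarrow> ('x + 'r) fpc set \<Rightarrow> ('x + 'r) fpc set" where
  "xmod_act C X R u A = rel_act C X R u ` A"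

definition identities_carrier ::
  "nat monoid set \<Rightarrow> 'x topology \<Rightarrow> 'r topology \<Rightarrow> ('r \<Rightarrow> 'x fpc) \<Rightarrow> ('x + 'r) fpc set set" where
  "identities_carrier C X R \<omega> = kernel (xmod_grp C X R \<omega>) (free_proC C X) (xmod_boundary C X R \<omega>)"

definition identities_grp ::
  "nat monoid set \<Rightarrow> 'x topology \<Rightarrow> 'r topology \<Rightarrow> ('r \<Rightarrow> 'x fpc) \<Rightarrow> ('x + 'r) fpc set monoid" where
  "identities_grp C X R \<omega> = (xmod_grp C X R \<omega>)\<lparr>carrier := identities_carrier C X R \<omega>\<rparr>"

definition identities_top ::
  "nat monoid set \<Rightarrow> 'x topology \<Rightarrow> 'r topology \<Rightarrow> ('r \<Rightarrow> 'x fpc) \<Rightarrow> ('x + 'r) fpc set topology" where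
  "identities_top C X R \<omega> = subtopology (xmod_top C X R \<omega>) (identities_carrier C X R \<omega>)"


section \<open>Simplicial groups and the Moore complex\<close>

text \<open>\<open>face S n i\<close> is the face map from degree n to degree n - 1 (meaningful for n > 0 and i \<le> n) and
  \<open>degen S n i\<close> the degeneracy from degree n to degree n + 1 (for i \<le> n).\<close>

record 'a simplicial_group =
  sgrp :: "nat \<Rightarrow> 'a monoid"
  stop :: "nat \<Rightarrow> 'a topology"
  face :: "nat \<Rightarrow> nat \<Rightarrow> 'a \<Rightarrow> 'a"
  degen :: "nat \<Rightarrow> nat \<Rightarrow> 'a \<Rightarrow> 'a"

definition moore :: "'a simplicial_group \<Rightarrow> nat \<Rightarrow> 'a set" where
  "moore S n = {z \<in> carrier (sgrp S n). \<forall>i<n. face S n i z = \<one>\<^bsub>sgrp S (n - 1)\<^esub>}"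

definition moore_cycles :: "'a simplicial_group \<Rightarrow> nat \<Rightarrow> 'a set" where
  "moore_cycles S n = {z \<in> moore S n. n > 0 \<longrightarrow> face S n n z = \<one>\<^bsub>sgrp S (n - 1)\<^esub>}"

definition moore_boundaries :: "'a simplicial_group \<Rightarrow> nat \<Rightarrow> 'a set" where
  "moore_boundaries S n = face S (Suc n) (Suc n) ` moore S (Suc n)"

definition cycle_grp :: "'a simplicial_group \<Rightarrow> nat \<Rightarrow> 'a monoid" where
  "cycle_grp S n = (sgrp S n)\<lparr>carrier := moore_cycles S n\<rparr>"

definition homotopy_grp :: "'a simplicial_group \<Rightarrow> nat \<Rightarrow> 'a set monoid" where
  "homotopy_grp S n = cycle_grp S n Mod moore_boundaries S n"

definition homotopy_top :: "'a simplicial_group \<Rightarrow> nat \<Rightarrow> 'a set topology" where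
  "homotopy_top S n = quotient_topology (cycle_grp S n)
     (subtopology (stop S n) (moore_cycles S n)) (moore_boundaries S n)"

text \<open>The action of degree 0 on the first homotopy group, by conjugation through the degeneracy; it
  factors through the zeroth homotopy group.\<close>

definition homotopy1_act :: "'a simplicial_group \<Rightarrow> 'a \<Rightarrow> 'a set \<Rightarrow> 'a set" where
  "homotopy1_act S u A = conj_by (sgrp S 1) (degen S 0 0 u) ` A"


section \<open>The first step of the construction\<close>

text \<open>Monotone surjections from [n] onto [1], as functions that are undefined beyond n.\<close>

definition mono_surj :: "nat \<Rightarrow> (nat \<Rightarrow> nat) set" where
  "mono_surj n = {t \<in> extensional {..n}. mono_on {..n} t \<and> t ` {..n} = {..1}}"

definition coface :: "nat \<Rightarrow> nat \<Rightarrow> nat" where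
  "coface i j = (if j < i then j else Suc j)"

definition codegen :: "nat \<Rightarrow> nat \<Rightarrow> nat" where
  "codegen i j = (if j \<le> i then j else j - 1)"

type_synonym ('x, 'r) gens = "'x + (nat \<Rightarrow> nat) \<times> 'r"

definition step1_gens :: "'x topology \<Rightarrow> 'r topology \<Rightarrow> nat \<Rightarrow> ('x, 'r) gens topology" where
  "step1_gens X R n = plus_topology X (sum_topology (\<lambda>t. R) (mono_surj n))"

abbreviation step1_grp :: "nat monoid set \<Rightarrow> 'x topology \<Rightarrow> 'r topology \<Rightarrow> nat \<Rightarrow> ('x, 'r) gens fpc monoid" where
  "step1_grp C X R n \<equiv> free_proC C (step1_gens X R n)"

abbreviation step1_top :: "nat monoid set \<Rightarrow> 'x topology \<Rightarrow> 'r topology \<Rightarrow> nat \<Rightarrow> ('x, 'r) gens fpc topology" where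
  "step1_top C X R n \<equiv> free_proC_top C (step1_gens X R n)"

text \<open>The homomorphism from the free group on \<^term>\<open>X\<close> into degree n fixing \<^term>\<open>X\<close>; for n = 0 it is the
  canonical identification, since there are no monotone surjections from [0] onto [1].\<close>

definition step1_incl ::
  "nat monoid set \<Rightarrow> 'x topology \<Rightarrow> 'r topology \<Rightarrow> nat \<Rightarrow> 'x fpc \<Rightarrow> ('x, 'r) gens fpc" where
  "step1_incl C X R n = free_lift C X (step1_grp C X R n) (step1_top C X R n)
     (\<lambda>x. free_gen C (step1_gens X R n) (Inl x))"

definition step1_face_gen ::
  "nat monoid set \<Rightarrow> 'x topology \<Rightarrow> 'r topology \<Rightarrow> ('r \<Rightarrow> 'x fpc) \<Rightarrow> nat \<Rightarrow> nat \<Rightarrow> ('x, 'r) gens \<Rightarrow> ('x, 'r) gens fpc" where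
  "step1_face_gen C X R \<omega> n i g = (case g of
      Inl x \<Rightarrow> free_gen C (step1_gens X R (n - 1)) (Inl x)
    | Inr (t, \<rho>) \<Rightarrow>
       (let t' = restrict (t \<circ> coface i) {..n - 1} in
        if t' ` {..n - 1} = {..1} then free_gen C (step1_gens X R (n - 1)) (Inr (t', \<rho>))
        else if t' ` {..n - 1} = {0} then step1_incl C X R (n - 1) (\<omega> \<rho>)
        else \<one>\<^bsub>step1_grp C X R (n - 1)\<^esub>))"

definition step1_degen_gen ::
  "nat monoid set \<Rightarrow> 'x topology \<Rightarrow> 'r topology \<Rightarrow> nat \<Rightarrow> nat \<Rightarrow> ('x, 'r) gens \<Rightarrow> ('x, 'r) gens fpc" where
  "step1_degen_gen C X R n i g = (case g of
      Inl x \<Rightarrow> free_gen C (step1_gens X R (Suc n)) (Inl x)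
    | Inr (t, \<rho>) \<Rightarrow>
        free_gen C (step1_gens X R (Suc n)) (Inr (restrict (t \<circ> codegen i) {..Suc n}, \<rho>)))"

definition step1 ::
  "nat monoid set \<Rightarrow> 'x topology \<Rightarrow> 'r topology \<Rightarrow> ('r \<Rightarrow> 'x fpc) \<Rightarrow> ('x, 'r) gens fpc simplicial_group" where
  "step1 C X R \<omega> = \<lparr>
     sgrp = step1_grp C X R,
     stop = step1_top C X R,
     face = (\<lambda>n i. free_lift C (step1_gens X R n) (step1_grp C X R (n - 1)) (step1_top C X R (n - 1))
               (step1_face_gen C X R \<omega> n i)),
     degen = (\<lambda>n i. free_lift C (step1_gens X R n) (step1_grp C X R (Suc n)) (step1_top C X R (Suc n))
               (step1_degen_gen C X R n i))\<rparr>"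

end

(*
  Write F0, F1, F2 for the groups of F^(1) in degrees 0, 1, 2, so that F1 retracts onto F0 by d0 with
  kernel H, and d1 restricts to Theta on H. The cycles in degree 1 are ker Theta, so everything rests
  on d2 (ker d0 \<inter> ker d1) = P.

  P is normal in F1 and contains all commutators [x, b] with d1 x = 1 and b \<in> H, because such an x has
  the form h s0(Theta h)^-1 with h \<in> H. For a, b \<in> H the element
  s1(a) s1(b) s1(a)^-1 (s0(a) s1(b) s0(a)^-1)^-1 lies in ker d0 \<inter> ker d1 and d2 sends it to the Peiffer
  commutator of a and b. Conversely, modulo P the map
    z \<mapsto> d2(z) s0(e z)^-1 d0(z),  e = d0 d2 = d1 d0,
  is a homomorphism (this is composition in the groupoid attached to the crossed module F1/P), and it
  agrees with d1 on the generators of F2, which are degenerate; so the two agree everywhere, and for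
  z \<in> ker d0 \<inter> ker d1 this says d2(z) \<in> P.
*)

theory Submission
  imports Defs
begin

section \<open>Homomorphisms out of free pro-C groups\<close>

text \<open>The composition formula is not multiplicative in F1 itself: moving d2(w) s0(e w)^-1 past
  s0(e z)^-1 d0(z) costs a commutator of an element of ker d0 with one of ker d1, and this is where
  the Peiffer relations enter. Agreement on generators therefore has to be propagated modulo P,
  between continuous maps that are multiplicative only on cosets. No topology on F1/P is involved:
  the set where two continuous maps agree modulo a closed normal subgroup is already closed. Since P
  is a closed span, inclusions out of it are proved by exhibiting a closed subgroup that contains
  the Peiffer commutators; for d2 (ker d0 \<inter> ker d1), closedness comes from compactness. What
  remains is comparison. H lies in the free group on X + R, while degree 1 of F^(1) is free on
  generators of another type. Moreover pi_P is a subgroup of a quotient and pi_1 a quotient of a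
  subgroup, so an algebraic isomorphism does not by itself match the topologies.\<close>

lemma topological_groupD:
  assumes "topological_group G T"
  shows "group G" "topspace T = carrier G"
  using assms by (auto simp: topological_group_def)

lemma continuous_map_group_mult:
  assumes G: "topological_group G T" and f: "continuous_map X T f" and g: "continuous_map X T g"
  shows "continuous_map X T (\<lambda>x. f x \<otimes>\<^bsub>G\<^esub> g x)"
proof -
  have "continuous_map X (prod_topology T T) (\<lambda>x. (f x, g x))"
    using f g by (simp add: continuous_map_paired)
  moreover have "continuous_map (prod_topology T T) T (\<lambda>(x, y). x \<otimes>\<^bsub>G\<^esub> y)"
    using G by (simp add: topological_group_def)
  ultimately show ?thesis
    using continuous_map_compose by (fastforce simp: o_def)
qed

lemma continuous_map_group_inv:
  assumes "topological_group G T" "continuous_map X T f"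
  shows "continuous_map X T (\<lambda>x. inv\<^bsub>G\<^esub> f x)"
  using assms continuous_map_compose[of X T f T "\<lambda>x. inv\<^bsub>G\<^esub> x"]
  by (simp add: topological_group_def o_def)

lemma (in normal) coset_eq_iff:
  assumes "x \<in> carrier G" "y \<in> carrier G"
  shows "H #> x = H #> y \<longleftrightarrow> x \<otimes> inv y \<in> H"
proof -
  have sub: "subgroup H G" by (rule is_subgroup)
  have "H #> x = H #> y \<longleftrightarrow> x \<in> H #> y"
    using assms sub rcos_self repr_independence by metis
  then show ?thesis
    using assms is_group rcos_module by blast
qed

text \<open>The free group is a closed span inside the ambient product. A closed subgroup of it is
  also a closed subgroup of that product, so minimality of the span applies.\<close>

lemma free_proC_subset_closed_subgroup:
  assumes C: "closed_class C" and E: "subgroup E (free_proC C Y)" "closedin (free_proC_top C Y) E"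
    and gen: "\<And>y. y \<in> topspace Y \<Longrightarrow> free_gen C Y y \<in> E"
  shows "carrier (free_proC C Y) \<subseteq> E"
proof -
  let ?F = "free_proC C Y" and ?P = "free_prod C Y"
  have "subgroup E (?P\<lparr>carrier := carrier ?F\<rparr>)" using E(1) by (simp only: free_proC_eq[symmetric])
  then have sE: "subgroup E ?P"
    by (rule group.incl_subgroup[OF free_prod_group[OF C] free_subgroup[OF C]])
  have cE: "closedin (free_prod_top C Y) E"
    using E(2) free_closedin[OF C] unfolding free_proC_top_def by (rule closedin_trans_full)
  have "closed_span ?P (free_prod_top C Y) (free_gen C Y ` topspace Y) \<subseteq> E"
    by (rule closed_span_least[OF sE cE]) (use gen in auto)
  then show ?thesis by (simp add: free_proC_def)
qed

text \<open>Uniqueness of extensions from generators, relative to a closed normal subgroup. Neither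
  \<open>f\<close> nor \<open>g\<close> has to be a homomorphism; being one on cosets makes the
  agreement set a subgroup.\<close>

lemma free_proC_coset_eq:
  assumes C: "closed_class C" and K: "topological_group K TK" and N: "N \<lhd> K" "closedin TK N"
    and f: "continuous_map (free_proC_top C Y) TK f" "(\<lambda>z. N #>\<^bsub>K\<^esub> f z) \<in> hom (free_proC C Y) (K Mod N)"
    and g: "continuous_map (free_proC_top C Y) TK g" "(\<lambda>z. N #>\<^bsub>K\<^esub> g z) \<in> hom (free_proC C Y) (K Mod N)"
    and gen: "\<And>y. y \<in> topspace Y \<Longrightarrow> f (free_gen C Y y) \<otimes>\<^bsub>K\<^esub> inv\<^bsub>K\<^esub> g (free_gen C Y y) \<in> N"
    and z: "z \<in> carrier (free_proC C Y)"
  shows "f z \<otimes>\<^bsub>K\<^esub> inv\<^bsub>K\<^esub> (g z) \<in> N"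
proof -
  let ?F = "free_proC C Y"
  let ?E = "{z \<in> carrier ?F. N #>\<^bsub>K\<^esub> f z = N #>\<^bsub>K\<^esub> g z}"
  interpret N: normal N K by (rule N)
  note F = topological_groupD[OF free_proC_topological[OF C, of Y]] and tK = topological_groupD(2)[OF K]
  interpret p: group_hom ?F "K Mod N" "\<lambda>z. N #>\<^bsub>K\<^esub> f z"
    using F N.factorgroup_is_group f by (simp add: group_hom_def group_hom_axioms_def)
  interpret q: group_hom ?F "K Mod N" "\<lambda>z. N #>\<^bsub>K\<^esub> g z"
    using F N.factorgroup_is_group g by (simp add: group_hom_def group_hom_axioms_def)
  have fK: "f z \<in> carrier K" and gK: "g z \<in> carrier K" if "z \<in> carrier ?F" for z
    using f(1) g(1) that F(2) tK continuous_map_image_subset_topspace by blast+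
  \<comment> \<open>Rewriting equality of cosets as membership of a quotient in \<open>N\<close>
    presents the agreement set as the preimage of a closed set under a continuous map.\<close>
  have E_eq: "?E = {z \<in> topspace (free_proC_top C Y). f z \<otimes>\<^bsub>K\<^esub> inv\<^bsub>K\<^esub> (g z) \<in> N}"
    using fK gK F N.coset_eq_iff by (intro Collect_cong conj_cong) auto
  have "continuous_map (free_proC_top C Y) TK (\<lambda>z. f z \<otimes>\<^bsub>K\<^esub> inv\<^bsub>K\<^esub> (g z))"
    by (intro continuous_map_group_mult[OF K] continuous_map_group_inv[OF K] f g)
  then have cl: "closedin (free_proC_top C Y) ?E"
    unfolding E_eq using N(2) by (rule closedin_continuous_map_preimage)
  have sub: "subgroup ?E ?F"
  proof (rule group.subgroupI[OF F(1)])
    show "?E \<noteq> {}" using p.hom_one q.hom_one p.one_closed by blast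
    show "inv\<^bsub>?F\<^esub> a \<in> ?E" if "a \<in> ?E" for a
      using that p.hom_inv[of a] q.hom_inv[of a] by simp
    show "a \<otimes>\<^bsub>?F\<^esub> b \<in> ?E" if "a \<in> ?E" "b \<in> ?E" for a b
      using that p.hom_mult[of a b] q.hom_mult[of a b] by simp
  qed auto
  have "carrier ?F \<subseteq> ?E"
    by (rule free_proC_subset_closed_subgroup[OF C sub cl])
      (unfold E_eq F(2), use gen free_gen_in_free[OF C] in simp)
  then have "z \<in> ?E" using z by blast
  then show ?thesis unfolding E_eq by simp
qed

text \<open>Together with \<open>m_assoc\<close> and \<open>inv_mult_group\<close> these rules
  normalise group words, which proves the Peiffer identities by \<open>simp\<close>.\<close>

lemma (in group) inv_cancel_left:
  assumes "x \<in> carrier G" "y \<in> carrier G"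
  shows "inv x \<otimes> (x \<otimes> y) = y" "x \<otimes> (inv x \<otimes> y) = y"
  using assms by (simp_all add: m_assoc[symmetric])


section \<open>Peiffer commutators\<close>

text \<open>An internal reflexive graph in topological groups, abstracting d0, d1 and s0 between
  degrees 1 and 0. Elements of \<open>A\<close> are edges and elements of \<open>B\<close> are
  vertices; composition of edges becomes multiplicative only modulo the Peiffer commutators.\<close>

locale reflexive_topological_group =
  fixes A :: "('a, 'm) monoid_scheme" (structure) and TA :: "'a topology"
    and B :: "('b, 'n) monoid_scheme" and TB :: "'b topology"
    and src tgt :: "'a \<Rightarrow> 'b" and unit :: "'b \<Rightarrow> 'a"
  assumes topA: "topological_group A TA" and topB: "topological_group B TB"
    and hausB: "Hausdorff_space TB"
    and src_hom: "src \<in> hom A B" and src_cont: "continuous_map TA TB src"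
    and tgt_hom: "tgt \<in> hom A B" and tgt_cont: "continuous_map TA TB tgt"
    and unit_hom: "unit \<in> hom B A" and unit_cont: "continuous_map TB TA unit"
    and src_unit: "u \<in> carrier B \<Longrightarrow> src (unit u) = u"
    and tgt_unit: "u \<in> carrier B \<Longrightarrow> tgt (unit u) = u"
begin

sublocale A: group A by (rule topological_groupD(1)[OF topA])
sublocale B: group B by (rule topological_groupD(1)[OF topB])
sublocale src: group_hom A B src by unfold_locales (rule src_hom)
sublocale tgt: group_hom A B tgt by unfold_locales (rule tgt_hom)
sublocale unit: group_hom B A unit by unfold_locales (rule unit_hom)

abbreviation "ker \<equiv> kernel A B src"
abbreviation "ker_grp \<equiv> A\<lparr>carrier := ker\<rparr>"
abbreviation "ker_top \<equiv> subtopology TA ker"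

definition peiffer :: "'a \<Rightarrow> 'a \<Rightarrow> 'a" where
  "peiffer a b = conj_by A a b \<otimes> inv (conj_by A (unit (tgt a)) b)"

definition peiffer_span :: "'a set" where
  "peiffer_span = closed_span ker_grp ker_top {peiffer a b | a b. a \<in> ker \<and> b \<in> ker}"

section \<open>Closed kernels and the closed span of the Peiffer commutators\<close>

lemma closedin_kernel:
  assumes "f \<in> hom A B" "continuous_map TA TB f"
  shows "closedin TA (kernel A B f)"
proof -
  have "closedin TA {x \<in> topspace TA. f x \<in> {\<one>\<^bsub>B\<^esub>}}"
    using assms(2) by (rule closedin_continuous_map_preimage)
      (use closedin_Hausdorff_sing_eq[OF hausB] topological_groupD[OF topB] in auto)
  then show ?thesis
    using topological_groupD(2)[OF topA] by (simp add: kernel_def)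
qed

lemma closedin_ker: "closedin TA ker"
  by (rule closedin_kernel[OF src_hom src_cont])

lemma subgroup_ker: "subgroup ker A"
  by (rule src.subgroup_kernel)

lemma ker_iff: "a \<in> ker \<longleftrightarrow> a \<in> carrier A \<and> src a = \<one>\<^bsub>B\<^esub>"
  by (simp add: kernel_def)

lemma topological_group_ker: "topological_group ker_grp ker_top"
  by (rule topological_group_subgroup[OF topA subgroup_ker])

lemma conj_in_ker: "g \<in> carrier A \<Longrightarrow> b \<in> ker \<Longrightarrow> conj_by A g b \<in> ker"
  by (simp add: ker_iff conj_by_def)

lemma peiffer_in_ker: "a \<in> ker \<Longrightarrow> b \<in> ker \<Longrightarrow> peiffer a b \<in> ker"
  unfolding peiffer_def
  by (intro subgroup.m_closed[OF subgroup_ker] subgroup.m_inv_closed[OF subgroup_ker] conj_in_ker)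
    (auto simp: ker_iff)

lemma tgt_peiffer: "a \<in> ker \<Longrightarrow> b \<in> ker \<Longrightarrow> tgt (peiffer a b) = \<one>\<^bsub>B\<^esub>"
  by (simp add: ker_iff peiffer_def conj_by_def tgt_unit)

lemma
  subgroup_peiffer_span_ker: "subgroup peiffer_span ker_grp" and
  closedin_peiffer_span_ker: "closedin ker_top peiffer_span" and
  peiffer_in_span: "a \<in> ker \<Longrightarrow> b \<in> ker \<Longrightarrow> peiffer a b \<in> peiffer_span"
  using closed_span_props[OF topological_group_ker, of "{peiffer a b | a b. a \<in> ker \<and> b \<in> ker}"]
    peiffer_in_ker unfolding peiffer_span_def by auto

lemma subgroup_peiffer_span: "subgroup peiffer_span A"
  by (rule A.incl_subgroup[OF subgroup_ker subgroup_peiffer_span_ker])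

lemma closedin_peiffer_span: "closedin TA peiffer_span"
  by (rule closedin_trans_full[OF closedin_peiffer_span_ker closedin_ker])

lemma peiffer_span_subset_ker: "peiffer_span \<subseteq> ker"
  using subgroup.subset[OF subgroup_peiffer_span_ker] by simp

text \<open>The span is formed inside \<open>ker_grp\<close>, as in the definition of the crossed
  module. Intersecting with \<open>ker\<close> allows test subgroups of the whole group
  \<open>A\<close>.\<close>

lemma peiffer_span_least:
  assumes "subgroup K A" "closedin TA K" "\<And>a b. a \<in> ker \<Longrightarrow> b \<in> ker \<Longrightarrow> peiffer a b \<in> K"
  shows "peiffer_span \<subseteq> K"
proof -
  have "peiffer_span \<subseteq> K \<inter> ker" unfolding peiffer_span_def
  proof (rule closed_span_least)
    show "subgroup (K \<inter> ker) ker_grp"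
      using A.subgroup_incl[OF A.subgroups_Inter_pair[OF assms(1) subgroup_ker] subgroup_ker] by simp
    show "closedin ker_top (K \<inter> ker)"
      using assms(2) by (auto simp: closedin_subtopology)
  qed (use assms(3) peiffer_in_ker in auto)
  then show ?thesis by blast
qed

lemma tgt_peiffer_span: "z \<in> peiffer_span \<Longrightarrow> tgt z = \<one>\<^bsub>B\<^esub>"
  using peiffer_span_least[OF tgt.subgroup_kernel closedin_kernel[OF tgt_hom tgt_cont]] tgt_peiffer
    peiffer_in_ker unfolding kernel_def by auto

text \<open>Equivariance: conjugating \<open>a\<close> by \<open>unit u\<close> conjugates
  \<open>tgt a\<close> by \<open>u\<close>.\<close>

lemma conj_unit_peiffer:
  assumes "u \<in> carrier B" "a \<in> ker" "b \<in> ker"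
  shows "conj_by A (unit u) (peiffer a b) = peiffer (conj_by A (unit u) a) (conj_by A (unit u) b)"
  using assms
  by (simp add: ker_iff peiffer_def conj_by_def tgt_unit A.inv_mult_group A.m_assoc A.inv_cancel_left)

text \<open>The product rule for \<langle>h a, b\<rangle>, solved for its conjugated factor:
  expanding \<langle>h a, b\<rangle> gives the conjugate of \<langle>a, b\<rangle> by h, followed by
  \<langle>h, b'\<rangle> with b' the translate of b by \<open>tgt a\<close>.\<close>

lemma conj_ker_peiffer:
  assumes "h \<in> ker" "a \<in> ker" "b \<in> ker"
  shows "conj_by A h (peiffer a b) =
    peiffer (h \<otimes> a) b \<otimes> inv (peiffer h (conj_by A (unit (tgt a)) b))"
  using assms
  by (simp add: ker_iff peiffer_def conj_by_def A.inv_mult_group A.m_assoc A.inv_cancel_left)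

text \<open>\<open>A\<close> is the semidirect product of \<open>ker\<close> and the image of
  \<open>unit\<close>, and the two preceding identities treat the two factors of
  \<open>g\<close>.\<close>

lemma conj_peiffer_in_span:
  assumes g: "g \<in> carrier A" and ab: "a \<in> ker" "b \<in> ker"
  shows "conj_by A g (peiffer a b) \<in> peiffer_span"
proof -
  define u where "u = src g"
  define h where "h = g \<otimes> inv (unit u)"
  have u: "u \<in> carrier B" using g by (simp add: u_def)
  have h: "h \<in> ker" using g u by (simp add: h_def ker_iff src_unit) (simp add: u_def)
  have gh: "g = h \<otimes> unit u" using g u by (simp add: h_def A.m_assoc)
  define a' b' where "a' = conj_by A (unit u) a" and "b' = conj_by A (unit u) b"
  have ab': "a' \<in> ker" "b' \<in> ker" using ab u by (simp_all add: a'_def b'_def conj_in_ker)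
  have pc: "peiffer a b \<in> carrier A" using peiffer_in_ker[OF ab] by (simp add: ker_iff)
  have "conj_by A g (peiffer a b) = conj_by A h (conj_by A (unit u) (peiffer a b))"
    using h u pc by (simp add: gh conj_by_def ker_iff A.inv_mult_group A.m_assoc)
  also have "\<dots> = conj_by A h (peiffer a' b')"
    by (simp add: conj_unit_peiffer[OF u ab] a'_def b'_def)
  also have "\<dots> = peiffer (h \<otimes> a') b' \<otimes> inv (peiffer h (conj_by A (unit (tgt a')) b'))"
    by (rule conj_ker_peiffer[OF h ab'])
  also have "\<dots> \<in> peiffer_span"
  proof (intro subgroup.m_closed[OF subgroup_peiffer_span] subgroup.m_inv_closed[OF subgroup_peiffer_span] peiffer_in_span)
    show "h \<otimes> a' \<in> ker" using h ab' by (simp add: ker_iff)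
    show "conj_by A (unit (tgt a')) b' \<in> ker"
      using ab' by (intro conj_in_ker) (simp_all add: ker_iff)
  qed (use h ab' in simp_all)
  finally show ?thesis .
qed

lemma normal_peiffer_span: "peiffer_span \<lhd> A"
proof (subst A.normal_inv_iff, intro conjI ballI)
  show "subgroup peiffer_span A" by (rule subgroup_peiffer_span)
  fix g p assume g: "g \<in> carrier A" and p: "p \<in> peiffer_span"
  let ?c = "\<lambda>x. g \<otimes> x \<otimes> inv g"
  have tA: "topspace TA = carrier A" by (rule topological_groupD(2)[OF topA])
  have ch: "?c \<in> hom A A"
    using g by (intro homI) (simp_all add: A.m_assoc A.inv_cancel_left)
  interpret c: group_hom A A ?c by unfold_locales (rule ch)
  have cc: "continuous_map TA TA ?c"
    using g tA by (intro continuous_map_group_mult[OF topA]) auto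
  \<comment> \<open>A general element of the span is only a limit of words in the commutators. The
    preimage of the span under conjugation is a closed subgroup, so it suffices to test the
    commutators themselves.\<close>
  have "peiffer_span \<subseteq> {x \<in> carrier A. ?c x \<in> peiffer_span}"
  proof (rule peiffer_span_least)
    show "subgroup {x \<in> carrier A. ?c x \<in> peiffer_span} A"
    proof (rule A.subgroupI)
      show "{x \<in> carrier A. ?c x \<in> peiffer_span} \<noteq> {}"
        using c.hom_one subgroup.one_closed[OF subgroup_peiffer_span] by (metis (mono_tags) A.one_closed empty_Collect_eq)
      show "inv x \<in> {x \<in> carrier A. ?c x \<in> peiffer_span}" if "x \<in> {x \<in> carrier A. ?c x \<in> peiffer_span}" for x
        using that c.hom_inv[of x] subgroup.m_inv_closed[OF subgroup_peiffer_span, of "?c x"] by simp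
      show "x \<otimes> y \<in> {x \<in> carrier A. ?c x \<in> peiffer_span}"
        if "x \<in> {x \<in> carrier A. ?c x \<in> peiffer_span}" "y \<in> {x \<in> carrier A. ?c x \<in> peiffer_span}" for x y
        using that c.hom_mult[of x y] subgroup.m_closed[OF subgroup_peiffer_span, of "?c x" "?c y"] by simp
    qed auto
    show "closedin TA {x \<in> carrier A. ?c x \<in> peiffer_span}"
      using closedin_continuous_map_preimage[OF cc closedin_peiffer_span] by (simp add: tA)
    show "peiffer a b \<in> {x \<in> carrier A. ?c x \<in> peiffer_span}" if "a \<in> ker" "b \<in> ker" for a b
      using conj_peiffer_in_span[OF g that] peiffer_in_ker[OF that] by (simp add: conj_by_def ker_iff)
  qed
  then show "?c p \<in> peiffer_span" using p by blast
qed

lemma commutator_in_peiffer_span: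
  assumes x: "x \<in> carrier A" "tgt x = \<one>\<^bsub>B\<^esub>" and b: "b \<in> ker"
  shows "x \<otimes> b \<otimes> inv x \<otimes> inv b \<in> peiffer_span"
proof -
  define u where "u = src x"
  define h where "h = x \<otimes> inv (unit u)"
  have u: "u \<in> carrier B" using x by (simp add: u_def)
  have h: "h \<in> ker" using x u by (simp add: h_def ker_iff src_unit) (simp add: u_def)
  have th: "tgt h = inv\<^bsub>B\<^esub> u" using x u by (simp add: h_def tgt_unit)
  \<comment> \<open>Chosen so that conjugating \<open>b'\<close> by \<open>h\<close> gives the
    conjugate of \<open>b\<close> by \<open>x\<close>, while \<open>unit (tgt h)\<close>, the
    inverse of \<open>unit u\<close>, returns \<open>b'\<close> to \<open>b\<close>.\<close>
  define b' where "b' = conj_by A (unit u) b"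
  have b': "b' \<in> ker" using b u by (simp add: b'_def conj_in_ker)
  have "peiffer h b' = x \<otimes> b \<otimes> inv x \<otimes> inv b"
    using x u b by (simp add: peiffer_def th) (simp add: b'_def h_def conj_by_def ker_iff A.inv_mult_group A.m_assoc A.inv_cancel_left)
  then show ?thesis using peiffer_in_span[OF h b'] by simp
qed

text \<open>The faces and degeneracies of degree 2 enter only through simplicial identities:
  \<open>sl\<close> stands for s_0 and \<open>sr\<close> for s_1, \<open>dd\<close> is d_1 d_0 = d_0
  d_2, and \<open>gen\<close> is the composition formula on generators.\<close>

lemma image_moore2_eq_peiffer_span:
  fixes d :: "nat \<Rightarrow> 'y fpc \<Rightarrow> 'a"
  assumes C: "closed_class C" and hausA: "Hausdorff_space TA"
    and d: "\<And>i. i \<le> 2 \<Longrightarrow> d i \<in> hom (free_proC C Y) A"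
      "\<And>i. i \<le> 2 \<Longrightarrow> continuous_map (free_proC_top C Y) TA (d i)"
    and s: "sl \<in> hom A (free_proC C Y)" "sr \<in> hom A (free_proC C Y)"
    and ds0: "\<And>a. a \<in> carrier A \<Longrightarrow> d 0 (sl a) = a" "\<And>a. a \<in> carrier A \<Longrightarrow> d 1 (sl a) = a"
      "\<And>a. a \<in> carrier A \<Longrightarrow> d 2 (sl a) = unit (tgt a)"
    and ds1: "\<And>a. a \<in> carrier A \<Longrightarrow> d 0 (sr a) = unit (src a)" "\<And>a. a \<in> carrier A \<Longrightarrow> d 1 (sr a) = a"
      "\<And>a. a \<in> carrier A \<Longrightarrow> d 2 (sr a) = a"
    and dd: "\<And>z. z \<in> carrier (free_proC C Y) \<Longrightarrow> tgt (d 0 z) = src (d 2 z)"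
    and gen: "\<And>y. y \<in> topspace Y \<Longrightarrow> d 1 (free_gen C Y y) =
        d 2 (free_gen C Y y) \<otimes> inv (unit (src (d 2 (free_gen C Y y)))) \<otimes> d 0 (free_gen C Y y)"
  shows "d 2 ` {z \<in> carrier (free_proC C Y). d 0 z = \<one> \<and> d 1 z = \<one>} = peiffer_span" (is "d 2 ` ?M = _")
proof
  let ?E = "free_proC C Y" and ?T = "free_proC_top C Y"
  note E = topological_groupD[OF free_proC_topological[OF C, of Y]]
  note tA = topological_groupD(2)[OF topA]
  interpret E: group ?E by (rule E(1))
  interpret d0: group_hom ?E A "d 0" by unfold_locales (simp add: d)
  interpret d1: group_hom ?E A "d 1" by unfold_locales (simp add: d)
  interpret d2: group_hom ?E A "d 2" by unfold_locales (simp add: d)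
  interpret sl: group_hom A ?E sl by unfold_locales (rule s)
  interpret sr: group_hom A ?E sr by unfold_locales (rule s)
  interpret P: normal peiffer_span A by (rule normal_peiffer_span)
  have Mk: "?M = kernel ?E A (d 0) \<inter> kernel ?E A (d 1)" by (auto simp: kernel_def)
  show "peiffer_span \<subseteq> d 2 ` ?M"
  proof (rule peiffer_span_least)
    have "subgroup ?M ?E"
      unfolding Mk by (rule E.subgroups_Inter_pair[OF d0.subgroup_kernel d1.subgroup_kernel])
    then show "subgroup (d 2 ` ?M) A" by (rule d2.subgroup_img_is_subgroup)
    \<comment> \<open>The set \<open>?M\<close> is closed in a compact group, so its image is
      compact and hence closed in the Hausdorff group \<open>A\<close>.\<close>
    have one: "closedin TA {\<one>}" using closedin_Hausdorff_sing_eq[OF hausA] tA by auto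
    have "?M = {z \<in> topspace ?T. d 0 z \<in> {\<one>}} \<inter> {z \<in> topspace ?T. d 1 z \<in> {\<one>}}" by (auto simp: E)
    also have "closedin ?T \<dots>"
      by (intro closedin_Int closedin_continuous_map_preimage[OF _ one]) (simp_all add: d)
    finally have "compactin ?T ?M" by (rule closedin_compact_space[OF free_proC_compact[OF C]])
    then have "compactin TA (d 2 ` ?M)" by (rule image_compactin) (simp add: d)
    then show "closedin TA (d 2 ` ?M)" by (rule compactin_imp_closedin[OF hausA])
    show "peiffer a b \<in> d 2 ` ?M" if ab: "a \<in> ker" "b \<in> ker" for a b
    proof (rule image_eqI)
      \<comment> \<open>\<open>d 0\<close> sends \<open>sr a\<close> and \<open>sr b\<close> to the
        unit because \<open>a\<close> and \<open>b\<close> lie in \<open>ker\<close>;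
        \<open>d 1\<close> makes the two conjugates equal; \<open>d 2\<close> turns
        \<open>sl a\<close> into \<open>unit (tgt a)\<close>, which produces the action term of the
        Peiffer commutator.\<close>
      let ?w = "sr a \<otimes>\<^bsub>?E\<^esub> sr b \<otimes>\<^bsub>?E\<^esub> inv\<^bsub>?E\<^esub> sr a \<otimes>\<^bsub>?E\<^esub>
        inv\<^bsub>?E\<^esub> (sl a \<otimes>\<^bsub>?E\<^esub> sr b \<otimes>\<^bsub>?E\<^esub> inv\<^bsub>?E\<^esub> sl a)"
      show "peiffer a b = d 2 ?w" "?w \<in> ?M"
        using ab by (simp_all add: ker_iff peiffer_def conj_by_def ds0 ds1 del: One_nat_def)
    qed
  qed
  \<comment> \<open>By \<open>dd\<close> this is the identity edge at the vertex where
    \<open>d 0 z\<close> ends and \<open>d 2 z\<close> starts; dividing by it composes the two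
    edges.\<close>
  define e where "e z = unit (src (d 2 z))" for z
  have e_hom: "e \<in> hom ?E A" unfolding e_def
    using hom_compose[OF hom_compose[OF d2.homh src_hom] unit_hom] by (simp add: o_def)
  interpret e: group_hom ?E A e by unfold_locales (rule e_hom)
  let ?D = "\<lambda>z. d 2 z \<otimes> inv (e z) \<otimes> d 0 z"
  have D_hom: "(\<lambda>z. peiffer_span #> ?D z) \<in> hom ?E (A Mod peiffer_span)"
  proof (rule homI)
    show "peiffer_span #> ?D z \<in> carrier (A Mod peiffer_span)" if "z \<in> carrier ?E" for z
      using that by (auto simp: carrier_FactGroup)
    fix z w assume zw: "z \<in> carrier ?E" "w \<in> carrier ?E"
    \<comment> \<open>In \<open>?D\<close> of the product the middle factors occur as
      \<open>b \<otimes> x\<close>, in the product of the values as \<open>x \<otimes> b\<close>.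
      Here \<open>tgt x\<close> is trivial by \<open>dd\<close> and \<open>b\<close> lies in
      \<open>ker\<close>, so the two orders agree modulo the span.\<close>
    define x where "x = inv (e z) \<otimes> d 0 z"
    define b where "b = d 2 w \<otimes> inv (e w)"
    have xb: "x \<in> carrier A" "b \<in> carrier A" using zw by (simp_all add: x_def b_def)
    have "tgt x = \<one>\<^bsub>B\<^esub>" using zw by (simp add: x_def e_def tgt_unit dd)
    moreover have "b \<in> ker" using zw by (simp add: b_def e_def ker_iff src_unit)
    ultimately have "x \<otimes> b \<otimes> inv x \<otimes> inv b \<in> peiffer_span"
      by (intro commutator_in_peiffer_span xb)
    then have "(x \<otimes> b) \<otimes> inv (b \<otimes> x) \<in> peiffer_span" using xb by (simp add: A.inv_mult_group A.m_assoc)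
    then have comm: "peiffer_span #> (b \<otimes> x) = peiffer_span #> (x \<otimes> b)"
      using xb P.coset_eq_iff[of "x \<otimes> b" "b \<otimes> x"] by simp
    have sum: "peiffer_span #> (v \<otimes> v') = (peiffer_span #> v) <#> (peiffer_span #> v')"
      if "v \<in> carrier A" "v' \<in> carrier A" for v v' using that by (simp add: P.rcos_sum)
    have "?D (z \<otimes>\<^bsub>?E\<^esub> w) = d 2 z \<otimes> ((b \<otimes> x) \<otimes> d 0 w)"
      using zw by (simp add: x_def b_def A.inv_mult_group A.m_assoc)
    then have "peiffer_span #> ?D (z \<otimes>\<^bsub>?E\<^esub> w) = peiffer_span #> (d 2 z \<otimes> ((x \<otimes> b) \<otimes> d 0 w))"
      using zw xb by (simp only: sum comm A.m_closed d2.hom_closed d0.hom_closed)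
    also have "d 2 z \<otimes> ((x \<otimes> b) \<otimes> d 0 w) = ?D z \<otimes> ?D w"
      using zw by (simp add: x_def b_def A.m_assoc)
    finally show "peiffer_span #> ?D (z \<otimes>\<^bsub>?E\<^esub> w) =
        (peiffer_span #> ?D z) \<otimes>\<^bsub>A Mod peiffer_span\<^esub> (peiffer_span #> ?D w)"
      using zw by (simp add: sum)
  qed
  have d1_hom: "(\<lambda>z. peiffer_span #> d 1 z) \<in> hom ?E (A Mod peiffer_span)"
    using hom_compose[OF d1.homh P.r_coset_hom_Mod] by (simp add: o_def)
  have e_cont: "continuous_map ?T TA e" unfolding e_def
    using continuous_map_compose[OF continuous_map_compose[OF d(2)[of 2] src_cont] unit_cont]
    by (simp add: o_def)
  have D_cont: "continuous_map ?T TA ?D"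
    by (intro continuous_map_group_mult[OF topA] continuous_map_group_inv[OF topA] e_cont d) simp_all
  have D_mod: "?D z \<otimes> inv (d 1 z) \<in> peiffer_span" if "z \<in> carrier ?E" for z
  proof (rule free_proC_coset_eq[OF C topA normal_peiffer_span closedin_peiffer_span D_cont D_hom d(2) d1_hom _ that])
    fix y assume y: "y \<in> topspace Y"
    then have "?D (free_gen C Y y) = d 1 (free_gen C Y y)" using gen by (simp add: e_def)
    then show "?D (free_gen C Y y) \<otimes> inv (d 1 (free_gen C Y y)) \<in> peiffer_span"
      using free_gen_in_free[OF C y] subgroup.one_closed[OF subgroup_peiffer_span] by (simp del: One_nat_def)
  qed simp
  show "d 2 ` ?M \<subseteq> peiffer_span"
  proof (rule image_subsetI)
    fix z assume z: "z \<in> ?M"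
    \<comment> \<open>As \<open>d 0 z\<close> is trivial, so is the middle vertex. Hence
      \<open>e z\<close> is trivial and \<open>?D z\<close> reduces to \<open>d 2 z\<close>, which
      is congruent to \<open>d 1 z\<close>, the unit.\<close>
    then have "src (d 2 z) = \<one>\<^bsub>B\<^esub>" using dd[of z] by simp
    then show "d 2 z \<in> peiffer_span" using z D_mod[of z] by (simp add: e_def)
  qed
qed

end


section \<open>Quotients of closed subgroups\<close>

lemma topspace_final_topology [simp]: "topspace (final_topology T q) = q ` topspace T"
proof -
  have "openin (final_topology T q) (q ` topspace T)"
  proof -
    have "{x \<in> topspace T. q x \<in> q ` topspace T} = topspace T" by auto
    then show ?thesis by (simp only: openin_final_topology) simp
  qed
  moreover have "topspace (final_topology T q) \<subseteq> q ` topspace T"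
    using openin_topspace[of "final_topology T q"] unfolding openin_final_topology by (rule conjunct1)
  ultimately show ?thesis using openin_subset by blast
qed

text \<open>On K/P, the subspace topology of H/P agrees with the quotient topology of K. The point
  is to extend open sets from K/P to H/P, which works because K is closed and a union of
  P-cosets.\<close>

lemma openin_quotient_closed_subgroup:
  assumes H: "group H" "topspace TH = carrier H" and P: "P \<lhd> H"
    and K: "subgroup K H" "P \<subseteq> K" "closedin TH K"
    and V: "V \<subseteq> (\<lambda>x. P #>\<^bsub>H\<^esub> x) ` K"
  shows "openin (subtopology (quotient_topology H TH P) ((\<lambda>x. P #>\<^bsub>H\<^esub> x) ` K)) V \<longleftrightarrow>
    openin (subtopology TH K) {h \<in> K. P #>\<^bsub>H\<^esub> h \<in> V}" (is "openin (subtopology ?T (?q ` K)) V \<longleftrightarrow> openin _ ?V")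
proof
  interpret group H by (rule H)
  interpret P: normal P H by (rule P)
  have KH: "K \<subseteq> carrier H" using K(1) by (rule subgroup.subset)
  have tT: "topspace ?T = ?q ` carrier H" by (simp add: quotient_topology_def H)
  have sat: "h \<in> K" if h: "h \<in> carrier H" "?q h \<in> ?q ` K" for h
  proof -
    obtain k where k: "k \<in> K" "?q h = ?q k" using h by blast
    then have "h \<otimes>\<^bsub>H\<^esub> inv\<^bsub>H\<^esub> k \<in> K" using P.coset_eq_iff[of h k] h KH K(2) by blast
    then have "h \<otimes>\<^bsub>H\<^esub> inv\<^bsub>H\<^esub> k \<otimes>\<^bsub>H\<^esub> k \<in> K" using k K(1) by (simp add: subgroup.m_closed)
    then show ?thesis using h k KH by (simp add: m_assoc subset_iff)
  qed
  {
    assume "openin (subtopology ?T (?q ` K)) V"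
    then obtain W where W: "openin ?T W" "V = W \<inter> ?q ` K" by (auto simp: openin_subtopology)
    have "?V = {h \<in> topspace TH. ?q h \<in> W} \<inter> K" unfolding H(2) W(2) using KH by blast
    moreover have "openin TH {h \<in> topspace TH. ?q h \<in> W}"
      using W(1) by (simp add: quotient_topology_def openin_final_topology)
    ultimately show "openin (subtopology TH K) ?V" by (auto simp: openin_subtopology)
  }
  assume V': "openin (subtopology TH K) ?V"
  have tK: "topspace (subtopology TH K) = K" using KH H(2) by auto
  \<comment> \<open>The largest subset of H/P that meets K/P in \<open>V\<close>. Its preimage is
    the complement of \<open>K - ?V\<close>, which is closed in H because K is.\<close>
  let ?W = "?q ` carrier H - (?q ` K - V)"
  have "closedin (subtopology TH K) (K - ?V)"
    using closedin_diff[OF closedin_topspace V'] by (simp only: tK)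
  then have "closedin TH (K - ?V)" using K(3) by (rule closedin_trans_full)
  then have "openin TH (carrier H - (K - ?V))" 
    using openin_diff[OF openin_topspace] by (simp only: H(2)[symmetric])
  also have "carrier H - (K - ?V) = {h \<in> topspace TH. ?q h \<in> ?W}"
    unfolding H(2) using sat V KH by blast
  finally have "openin ?T ?W"
    unfolding quotient_topology_def openin_final_topology by (simp add: H(2))
  moreover have "V = ?W \<inter> ?q ` K" using V KH by blast
  ultimately show "openin (subtopology ?T (?q ` K)) V" unfolding openin_subtopology by blast
qed

lemma image_coset:
  assumes "J \<in> hom S H" "N \<subseteq> carrier S" "z \<in> carrier S"
  shows "J ` (N #>\<^bsub>S\<^esub> z) = (J ` N) #>\<^bsub>H\<^esub> J z"
proof -
  have "J (n \<otimes>\<^bsub>S\<^esub> z) = J n \<otimes>\<^bsub>H\<^esub> J z" if "n \<in> N" for n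
    using assms that by (auto intro: hom_mult)
  then show ?thesis by (simp add: r_coset_def image_UN)
qed

text \<open>Exchanges a quotient of a subgroup for a subgroup of a quotient: \<open>J\<close>
  identifies S with K and N with P, so taking images of sets carries cosets of N to cosets of
  P.\<close>

lemma
  assumes H: "group H" "topspace TH = carrier H" and P: "P \<lhd> H"
    and K: "subgroup K H" "P \<subseteq> K" "closedin TH K"
    and S: "group S" "topspace TS = carrier S" and N: "N \<subseteq> carrier S" "J ` N = P"
    and J: "J \<in> iso S (H\<lparr>carrier := K\<rparr>)" "homeomorphic_map TS (subtopology TH K) J"
  shows quotient_iso_image: "image J \<in> iso (S Mod N) ((H Mod P)\<lparr>carrier := (\<lambda>x. P #>\<^bsub>H\<^esub> x) ` K\<rparr>)"
    and quotient_homeomorphic_map_image: "homeomorphic_map (quotient_topology S TS N)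
      (subtopology (quotient_topology H TH P) ((\<lambda>x. P #>\<^bsub>H\<^esub> x) ` K)) (image J)"
proof -
  let ?q = "\<lambda>x. P #>\<^bsub>H\<^esub> x" and ?p = "\<lambda>x. N #>\<^bsub>S\<^esub> x"
  interpret S: group S by (rule S)
  have KH: "K \<subseteq> carrier H" using K(1) by (rule subgroup.subset)
  have JK: "J ` carrier S = K" and Ji: "inj_on J (carrier S)" and JH: "J \<in> hom S H"
    using J(1) KH by (auto simp: iso_def bij_betw_def hom_def)
  have Jp: "J ` ?p z = ?q (J z)" if "z \<in> carrier S" for z
    using image_coset[OF JH N(1) that] N(2) by simp
  have pS: "?p z \<subseteq> carrier S" if "z \<in> carrier S" for z
    using that N(1) by (rule S.r_coset_subset_G[rotated])
  have img: "image J ` ?p ` carrier S = ?q ` K"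
    unfolding JK[symmetric] using Jp by (simp add: image_image)
  have inj: "inj_on (image J) (?p ` carrier S)"
    using inj_on_image_Pow[OF Ji] by (rule inj_on_subset) (use pS in auto)
  show "image J \<in> iso (S Mod N) ((H Mod P)\<lparr>carrier := ?q ` K\<rparr>)"
  proof (rule isoI)
    show "image J \<in> hom (S Mod N) ((H Mod P)\<lparr>carrier := ?q ` K\<rparr>)"
    proof (rule homI)
      show "J ` A \<in> carrier ((H Mod P)\<lparr>carrier := ?q ` K\<rparr>)" if "A \<in> carrier (S Mod N)" for A
        using imageI[OF that, of "image J"] img by (simp add: carrier_FactGroup)
      fix A B assume "A \<in> carrier (S Mod N)" "B \<in> carrier (S Mod N)"
      then have "A \<subseteq> carrier S" "B \<subseteq> carrier S" using pS by (auto simp: carrier_FactGroup)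
      then show "J ` (A \<otimes>\<^bsub>S Mod N\<^esub> B) = J ` A \<otimes>\<^bsub>(H Mod P)\<lparr>carrier := ?q ` K\<rparr>\<^esub> J ` B"
        using set_mult_hom[OF JH] by simp
    qed
    show "bij_betw (image J) (carrier (S Mod N)) (carrier ((H Mod P)\<lparr>carrier := ?q ` K\<rparr>))"
      using img inj by (simp add: bij_betw_def carrier_FactGroup)
  qed
  let ?Q = "quotient_topology S TS N" and ?T = "subtopology (quotient_topology H TH P) (?q ` K)"
  have tQ: "topspace ?Q = ?p ` carrier S" by (simp add: quotient_topology_def S)
  have tT: "topspace ?T = ?q ` K" using KH by (auto simp: quotient_topology_def H)
  \<comment> \<open>Openness on either side is openness of a preimage, in K or in S, and
    \<open>J\<close> matches these two preimages.\<close>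
  have open_iff: "openin ?T (image J ` U) \<longleftrightarrow> openin ?Q U" if U: "U \<subseteq> ?p ` carrier S" for U
  proof -
    have mem: "?q (J z) \<in> image J ` U \<longleftrightarrow> ?p z \<in> U" if z: "z \<in> carrier S" for z
      unfolding Jp[OF z, symmetric] using inj_on_image_mem_iff[OF inj _ U] z by blast
    have "{h \<in> K. ?q h \<in> image J ` U} = J ` {z \<in> carrier S. ?p z \<in> U}"
      unfolding JK[symmetric] using mem by blast
    moreover have "image J ` U \<subseteq> ?q ` K" unfolding img[symmetric] using U by (rule image_mono)
    ultimately have "openin ?T (image J ` U) \<longleftrightarrow> openin (subtopology TH K) (J ` {z \<in> carrier S. ?p z \<in> U})"
      using openin_quotient_closed_subgroup[OF H P K] by simp
    also have "\<dots> \<longleftrightarrow> openin TS {z \<in> carrier S. ?p z \<in> U}"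
      by (rule homeomorphic_map_openness[OF J(2)]) (simp add: S)
    also have "\<dots> \<longleftrightarrow> openin ?Q U" using U by (simp add: quotient_topology_def openin_final_topology S)
    finally show ?thesis .
  qed
  show "homeomorphic_map ?Q ?T (image J)"
  proof (rule bijective_open_imp_homeomorphic_map)
    show "continuous_map ?Q ?T (image J)"
      unfolding continuous_map_def
    proof (intro conjI allI impI)
      show "image J \<in> topspace ?Q \<rightarrow> topspace ?T"
        unfolding tQ tT unfolding img[symmetric] by blast
      fix V assume V: "openin ?T V"
      then have "V \<subseteq> image J ` topspace ?Q" 
        using openin_subset[OF V] by (simp only: tQ tT img)
      then have "image J ` {x \<in> topspace ?Q. J ` x \<in> V} = V" by blast
      then show "openin ?Q {x \<in> topspace ?Q. J ` x \<in> V}"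
        using V open_iff[of "{x \<in> topspace ?Q. J ` x \<in> V}"] by (simp add: tQ)
    qed
    show "open_map ?Q ?T (image J)"
      unfolding open_map_def
    proof (intro allI impI)
      fix U assume "openin ?Q U"
      then show "openin ?T (image J ` U)"
        using open_iff[of U] openin_subset[of ?Q U] by (simp only: tQ)
    qed
  qed (use img inj tQ tT in simp_all)
qed


section \<open>Generators of the simplicial group\<close>

lemma continuous_map_Inl: "continuous_map X (plus_topology X Y) Inl"
  unfolding continuous_map_def openin_plus_topology
proof (intro conjI allI impI)
  fix U assume U: "U \<subseteq> topspace X <+> topspace Y \<and> openin X (Inl -` U) \<and> openin Y (Inr -` U)"
  then have "{x \<in> topspace X. Inl x \<in> U} = Inl -` U" by auto
  then show "openin X {x \<in> topspace X. Inl x \<in> U}" using U by simp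
qed auto

lemma continuous_map_Inr: "continuous_map Y (plus_topology X Y) Inr"
  unfolding continuous_map_def openin_plus_topology
proof (intro conjI allI impI)
  fix U assume U: "U \<subseteq> topspace X <+> topspace Y \<and> openin X (Inl -` U) \<and> openin Y (Inr -` U)"
  then have "{x \<in> topspace Y. Inr x \<in> U} = Inr -` U" by auto
  then show "openin Y {x \<in> topspace Y. Inr x \<in> U}" using U by simp
qed auto

lemma continuous_map_from_plus_topology:
  assumes "continuous_map X T (\<lambda>x. f (Inl x))" "continuous_map Y T (\<lambda>y. f (Inr y))"
  shows "continuous_map (plus_topology X Y) T f"
  unfolding continuous_map_def openin_plus_topology
proof (intro conjI allI impI)
  show "f \<in> topspace (plus_topology X Y) \<rightarrow> topspace T"
    using assms by (auto simp: continuous_map_def)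
  fix U assume U: "openin T U"
  let ?V = "{x \<in> topspace (plus_topology X Y). f x \<in> U}"
  show "?V \<subseteq> topspace X <+> topspace Y" by auto
  have "Inl -` ?V = {x \<in> topspace X. f (Inl x) \<in> U}" by auto
  then show "openin X (Inl -` ?V)" using openin_continuous_map_preimage[OF assms(1) U] by (simp only:)
  have "Inr -` ?V = {y \<in> topspace Y. f (Inr y) \<in> U}" by auto
  then show "openin Y (Inr -` ?V)" using openin_continuous_map_preimage[OF assms(2) U] by (simp only:)
qed

lemma continuous_map_from_sum_topology:
  assumes "\<And>i. i \<in> I \<Longrightarrow> continuous_map (X i) T (\<lambda>x. f (i, x))"
  shows "continuous_map (sum_topology X I) T f"
  unfolding continuous_map_def openin_sum_topology
proof (intro conjI allI impI ballI)
  have "f (i, x) \<in> topspace T" if "i \<in> I" "x \<in> topspace (X i)" for i x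
    using assms[OF that(1)] that(2) by (auto simp: continuous_map_def)
  then show "f \<in> topspace (sum_topology X I) \<rightarrow> topspace T" by auto
  fix U assume U: "openin T U"
  let ?V = "{x \<in> topspace (sum_topology X I). f x \<in> U}"
  show "?V \<subseteq> Sigma I (topspace \<circ> X)" by auto
  fix i assume i: "i \<in> I"
  then have "{x. (i, x) \<in> ?V} = {x \<in> topspace (X i). f (i, x) \<in> U}" by auto
  then show "openin (X i) {x. (i, x) \<in> ?V}"
    using openin_continuous_map_preimage[OF assms[OF i] U] by (simp only:)
qed

text \<open>The monotone maps from [n] to [1], indexed by the number k of zeros among their values; the
  surjections are those with 1 \<le> k \<le> n, while k = 0 and k = n + 1 give the constant maps.\<close>

definition jump :: "nat \<Rightarrow> nat \<Rightarrow> nat \<Rightarrow> nat" where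
  "jump n k = (\<lambda>i\<in>{..n}. if i < k then 0 else 1)"

lemma jump_0_image: "jump n 0 ` {..n} = {1}"
  by (auto simp: jump_def)

lemma jump_Suc_image: "jump n (Suc n) ` {..n} = {0}"
  by (auto simp: jump_def)

lemma jump_image:
  assumes "1 \<le> k" "k \<le> n"
  shows "jump n k ` {..n} = {..1}"
proof
  have "jump n k 0 = 0" "jump n k n = 1" using assms by (auto simp: jump_def)
  then have "0 \<in> jump n k ` {..n}" "1 \<in> jump n k ` {..n}"
    by (metis atMost_iff imageI le0 order_refl)+
  moreover have "{..1} = {0, 1::nat}" by auto
  ultimately show "{..1} \<subseteq> jump n k ` {..n}" by simp
qed (auto simp: jump_def)

lemma mono_surj_eq: "mono_surj n = jump n ` {1..n}"
proof
  show "jump n ` {1..n} \<subseteq> mono_surj n"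
    using jump_image by (auto simp: mono_surj_def) (auto simp: jump_def mono_on_def)
  show "mono_surj n \<subseteq> jump n ` {1..n}"
  proof
    fix t assume "t \<in> mono_surj n"
    then have t: "t \<in> extensional {..n}" "mono_on {..n} t" "t ` {..n} = {..1}"
      by (auto simp: mono_surj_def)
    define Z where "Z = {i \<in> {..n}. t i = 0}"
    have fin: "finite Z" by (simp add: Z_def)
    have "0 \<in> t ` {..n}" "1 \<in> t ` {..n}" using t(3) by auto
    then obtain i j where ij: "i \<le> n" "t i = 0" "j \<le> n" "t j = 1" by force
    have ne: "Z \<noteq> {}" using ij by (auto simp: Z_def)
    \<comment> \<open>The last zero. By monotonicity the zeros form the initial segment up to
      \<open>m\<close>, so there are \<open>Suc m\<close> of them.\<close>
    define m where "m = Max Z"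
    have m: "m \<le> n" "t m = 0" using Max_in[OF fin ne] by (auto simp: m_def Z_def)
    have zero: "t l = 0 \<longleftrightarrow> l \<le> m" if l: "l \<le> n" for l
    proof
      show "l \<le> m" if "t l = 0" using Max_ge[OF fin, of l] l that by (simp add: m_def Z_def)
      show "t l = 0" if "l \<le> m" using mono_onD[OF t(2), of l m] l m that by simp
    qed
    have le1: "t l \<le> 1" if "l \<le> n" for l using t(3) that by auto
    have "t = jump n (Suc m)"
    proof
      fix l show "t l = jump n (Suc m) l"
        using t(1) zero[of l] le1[of l] by (cases "l \<le> n") (auto simp: jump_def extensional_def)
    qed
    moreover have "m < n" using zero[of j] ij by simp
    ultimately show "t \<in> jump n ` {1..n}" by auto
  qed
qed

text \<open>Precomposing with the coface deletes the value at \<open>i\<close>, which is a zero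
  exactly when \<open>i < k\<close>.\<close>

lemma jump_coface:
  assumes "0 < n" "k \<le> Suc n" "i \<le> n"
  shows "restrict (jump n k \<circ> coface i) {..n - 1} = jump (n - 1) (if i < k then k - 1 else k)"
  using assms by (auto simp: jump_def coface_def fun_eq_iff)

lemma step1_face_gen_Inl:
  "step1_face_gen C X R \<omega> n i (Inl x) = free_gen C (step1_gens X R (n - 1)) (Inl x)"
  by (simp add: step1_face_gen_def)

text \<open>The three cases of the face formula become arithmetic: in degree n - 1 the count
  \<open>k' = 0\<close> is the constant map 1 and \<open>k' = n\<close> the constant map 0.\<close>

lemma step1_face_gen_jump:
  assumes n: "0 < n" and k: "1 \<le> k" "k \<le> n" and i: "i \<le> n"
  shows "step1_face_gen C X R \<omega> n i (Inr (jump n k, \<rho>)) = (let k' = if i < k then k - 1 else k in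
    if k' = 0 then \<one>\<^bsub>step1_grp C X R (n - 1)\<^esub>
    else if k' = n then step1_incl C X R (n - 1) (\<omega> \<rho>)
    else free_gen C (step1_gens X R (n - 1)) (Inr (jump (n - 1) k', \<rho>)))"
proof -
  define k' where "k' = (if i < k then k - 1 else k)"
  have r: "restrict (jump n k \<circ> coface i) {..n - 1} = jump (n - 1) k'"
    unfolding k'_def by (rule jump_coface) (use assms in auto)
  have "k' = 0 \<or> k' = n \<or> (1 \<le> k' \<and> k' \<le> n - 1)" using assms by (auto simp: k'_def)
  then consider "k' = 0" | "k' = n" "k' \<noteq> 0" | "1 \<le> k'" "k' \<le> n - 1" by blast
  then show ?thesis
  proof cases
    case 1
    then show ?thesis unfolding step1_face_gen_def sum.case prod.case r k'_def[symmetric]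
      using jump_0_image[of "n - 1"] by (simp add: Let_def atMost_Suc)
  next
    case 2
    then show ?thesis unfolding step1_face_gen_def sum.case prod.case r k'_def[symmetric]
      using jump_Suc_image[of "n - 1"] n by (simp add: Let_def atMost_Suc)
  next
    case 3
    moreover have "k' \<noteq> n" using 3 n by arith
    ultimately show ?thesis unfolding step1_face_gen_def sum.case prod.case r k'_def[symmetric]
      using jump_image[of k' "n - 1"] n by (simp add: Let_def)
  qed
qed

section \<open>Generators indexed by the number of zeros\<close>

lemma topspace_step1_gens_cases:
  assumes "g \<in> topspace (step1_gens X R n)"
  obtains (gen) x where "g = Inl x" "x \<in> topspace X"
    | (rel) k \<rho> where "g = Inr (jump n k, \<rho>)" "1 \<le> k" "k \<le> n" "\<rho> \<in> topspace R"
  using assms by (force simp: step1_gens_def mono_surj_eq)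

lemma Inl_in_step1_gens: "x \<in> topspace X \<Longrightarrow> Inl x \<in> topspace (step1_gens X R n)"
  by (auto simp: step1_gens_def)

lemma Inr_in_step1_gens:
  "1 \<le> k \<Longrightarrow> k \<le> n \<Longrightarrow> \<rho> \<in> topspace R \<Longrightarrow> Inr (jump n k, \<rho>) \<in> topspace (step1_gens X R n)"
  by (auto simp: step1_gens_def mono_surj_eq)

lemma continuous_map_from_step1_gens:
  assumes "continuous_map X T (\<lambda>x. f (Inl x))"
    and "\<And>k. 1 \<le> k \<Longrightarrow> k \<le> n \<Longrightarrow> continuous_map R T (\<lambda>\<rho>. f (Inr (jump n k, \<rho>)))"
  shows "continuous_map (step1_gens X R n) T f"
  unfolding step1_gens_def
  by (intro continuous_map_from_plus_topology continuous_map_from_sum_topology assms)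
    (use assms(2) in \<open>auto simp: mono_surj_eq\<close>)

lemma continuous_map_Inl_step1_gens: "continuous_map X (step1_gens X R n) Inl"
  unfolding step1_gens_def by (rule continuous_map_Inl)

lemma continuous_map_Inr_step1_gens:
  assumes "1 \<le> k" "k \<le> n"
  shows "continuous_map R (step1_gens X R n) (\<lambda>\<rho>. Inr (jump n k, \<rho>))"
proof -
  have "continuous_map R (sum_topology (\<lambda>t. R) (mono_surj n)) (\<lambda>\<rho>. (jump n k, \<rho>))"
    using assms by (intro continuous_map_component_injection[of _ _ "\<lambda>t. R"]) (simp add: mono_surj_eq)
  then show ?thesis
    unfolding step1_gens_def using continuous_map_compose[OF _ continuous_map_Inr]
    by (fastforce simp: o_def)
qed


section \<open>Comparison maps between free groups\<close>

text \<open>\<open>C_ne\<close> makes the free groups themselves pro-C groups, hence admissible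
  targets of the universal property.\<close>

locale relator_map =
  fixes C :: "nat monoid set" and X :: "'x topology" and R :: "'r topology" and \<omega> :: "'r \<Rightarrow> 'x fpc"
  assumes closed_C: "closed_class C" and C_ne: "C \<noteq> {}"
    and \<omega>_cont: "continuous_map R (free_proC_top C X) \<omega>"
begin

abbreviation lift :: "'y topology \<Rightarrow> 'z topology \<Rightarrow> ('y \<Rightarrow> 'z fpc) \<Rightarrow> 'y fpc \<Rightarrow> 'z fpc" where
  "lift Y Z \<equiv> free_lift C Y (free_proC C Z) (free_proC_top C Z)"

definition free_hom :: "'y topology \<Rightarrow> 'z topology \<Rightarrow> ('y fpc \<Rightarrow> 'z fpc) \<Rightarrow> bool" where
  "free_hom Y Z f \<longleftrightarrow> f \<in> hom (free_proC C Y) (free_proC C Z) \<and>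
     continuous_map (free_proC_top C Y) (free_proC_top C Z) f"

lemma group_free: "group (free_proC C Y)"
  by (rule topological_groupD(1)[OF free_proC_topological[OF closed_C]])

lemma topspace_free: "topspace (free_proC_top C Y) = carrier (free_proC C Y)"
  by (rule topological_groupD(2)[OF free_proC_topological[OF closed_C]])

lemma free_hom_lift:
  "continuous_map Y (free_proC_top C Z) f \<Longrightarrow> free_hom Y Z (lift Y Z f)"
  unfolding free_hom_def
  by (intro conjI free_lift_props(1,2)[OF closed_C free_proC_is_proC_group[OF closed_C C_ne]])

lemma lift_gen:
  "continuous_map Y (free_proC_top C Z) f \<Longrightarrow> y \<in> topspace Y \<Longrightarrow> lift Y Z f (free_gen C Y y) = f y"
  by (rule free_lift_props(3)[OF closed_C free_proC_is_proC_group[OF closed_C C_ne]])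

lemma free_hom_id: "free_hom Y Y (\<lambda>z. z)"
  by (simp add: free_hom_def hom_def)

lemma free_hom_compose: "free_hom Y Z f \<Longrightarrow> free_hom Z W g \<Longrightarrow> free_hom Y W (\<lambda>z. g (f z))"
  using hom_compose[of f "free_proC C Y" "free_proC C Z" g "free_proC C W"]
    continuous_map_compose[of "free_proC_top C Y" "free_proC_top C Z" f "free_proC_top C W" g]
  by (simp add: free_hom_def o_def)

lemma free_hom_group_hom: "free_hom Y Z f \<Longrightarrow> group_hom (free_proC C Y) (free_proC C Z) f"
  by (simp add: free_hom_def group_hom_def group_hom_axioms_def group_free)

lemma free_hom_closed: "free_hom Y Z f \<Longrightarrow> z \<in> carrier (free_proC C Y) \<Longrightarrow> f z \<in> carrier (free_proC C Z)"
  by (auto simp: free_hom_def hom_def)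

lemma free_hom_one: "free_hom Y Z f \<Longrightarrow> f \<one>\<^bsub>free_proC C Y\<^esub> = \<one>\<^bsub>free_proC C Z\<^esub>"
  by (rule group_hom.hom_one[OF free_hom_group_hom])

text \<open>The identities between composites of comparison maps below are all reduced to generators
  in this way.\<close>

lemma free_hom_eq:
  assumes "free_hom Y Z f" "free_hom Y Z g"
    and "\<And>y. y \<in> topspace Y \<Longrightarrow> f (free_gen C Y y) = g (free_gen C Y y)"
    and "z \<in> carrier (free_proC C Y)"
  shows "f z = g z"
  by (rule free_lift_unique[OF closed_C group_free[of Z] free_proC_Hausdorff[of C Z], where \<phi>=f and \<psi>=g])
    (use assms in \<open>simp_all add: free_hom_def\<close>)

lemma gen_in_free: "y \<in> topspace Y \<Longrightarrow> free_gen C Y y \<in> carrier (free_proC C Y)"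
  by (rule free_gen_in_free[OF closed_C])

lemma continuous_map_gen:
  "continuous_map W Y f \<Longrightarrow> continuous_map W (free_proC_top C Y) (\<lambda>w. free_gen C Y (f w))"
  using continuous_map_compose[OF _ free_gen_continuous[OF closed_C], of W Y f] by (simp add: o_def)

lemma continuous_map_one: "continuous_map W (free_proC_top C Y) (\<lambda>w. \<one>\<^bsub>free_proC C Y\<^esub>)"
  by (simp add: topspace_free monoid.one_closed[OF group.is_monoid[OF group_free]])

lemma continuous_map_free_hom:
  "free_hom Y Z f \<Longrightarrow> continuous_map W (free_proC_top C Y) g \<Longrightarrow>
    continuous_map W (free_proC_top C Z) (\<lambda>w. f (g w))"
  using continuous_map_compose[of W "free_proC_top C Y" g "free_proC_top C Z" f]
  by (simp add: free_hom_def o_def)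

section \<open>The comparison maps and their values on generators\<close>

abbreviation XR :: "('x + 'r) topology" where "XR \<equiv> plus_topology X R"
abbreviation Y :: "nat \<Rightarrow> ('x, 'r) gens topology" where "Y \<equiv> step1_gens X R"

abbreviation incl :: "'x fpc \<Rightarrow> ('x + 'r) fpc" where "incl \<equiv> XR_incl C X R"
abbreviation \<theta> :: "('x + 'r) fpc \<Rightarrow> 'x fpc" where "\<theta> \<equiv> XR_theta C X R \<omega>"
abbreviation d :: "nat \<Rightarrow> nat \<Rightarrow> ('x, 'r) gens fpc \<Rightarrow> ('x, 'r) gens fpc" where
  "d \<equiv> face (step1 C X R \<omega>)"

text \<open>The face d_0 on the free group on \<open>XR\<close>, just as \<open>\<theta>\<close> is
  the face d_1; see \<open>J0_face_0\<close> and \<open>J0_face_1\<close>.\<close>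

definition retr :: "('x + 'r) fpc \<Rightarrow> 'x fpc" where
  "retr = lift XR X (case_sum (free_gen C X) (\<lambda>_. \<one>\<^bsub>free_proC C X\<^esub>))"

text \<open>Up to the identification of \<open>XR\<close> with the generators in degree 1, \<open>\<sigma> k\<close> is the degeneracy
  \<open>s_(2 - k)\<close>: the index counts zeros, and \<open>s_i\<close> repeats the value at i.\<close>

definition \<sigma> :: "nat \<Rightarrow> ('x + 'r) fpc \<Rightarrow> ('x, 'r) gens fpc" where
  "\<sigma> k = lift XR (Y 2) (case_sum (\<lambda>x. free_gen C (Y 2) (Inl x)) (\<lambda>\<rho>. free_gen C (Y 2) (Inr (jump 2 k, \<rho>))))"

text \<open>\<open>J0\<close> and \<open>J\<close> identify degrees 0 and 1 with the free groups on \<open>X\<close> and \<open>XR\<close>. There are no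
  generators \<^term>\<open>Inr y\<close> in degree 0, so that branch of \<open>J0\<close> is arbitrary.\<close>

definition J0 :: "('x, 'r) gens fpc \<Rightarrow> 'x fpc" where
  "J0 = lift (Y 0) X (case_sum (free_gen C X) (\<lambda>_. \<one>\<^bsub>free_proC C X\<^esub>))"

definition J :: "('x, 'r) gens fpc \<Rightarrow> ('x + 'r) fpc" where
  "J = lift (Y 1) XR (case_sum (\<lambda>x. free_gen C XR (Inl x)) (\<lambda>(t, \<rho>). free_gen C XR (Inr \<rho>)))"

text \<open>\<open>jump 1 1\<close> is the identity of [1], the only monotone surjection from [1]
  onto itself.\<close>

definition J_inv :: "('x + 'r) fpc \<Rightarrow> ('x, 'r) gens fpc" where
  "J_inv = lift XR (Y 1) (case_sum (\<lambda>x. free_gen C (Y 1) (Inl x)) (\<lambda>\<rho>. free_gen C (Y 1) (Inr (jump 1 1, \<rho>))))"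

lemma Inl_in_XR: "x \<in> topspace X \<Longrightarrow> Inl x \<in> topspace XR" and Inr_in_XR: "\<rho> \<in> topspace R \<Longrightarrow> Inr \<rho> \<in> topspace XR"
  by auto

lemmas gens_in = Inl_in_XR Inr_in_XR Inl_in_step1_gens Inr_in_step1_gens

lemmas cont_intros = continuous_map_gen continuous_map_one continuous_map_Inl continuous_map_Inr
  continuous_map_Inl_step1_gens continuous_map_Inr_step1_gens free_gen_continuous[OF closed_C] \<omega>_cont

lemma
  free_hom_incl: "free_hom X XR incl" and
  incl_gen: "x \<in> topspace X \<Longrightarrow> incl (free_gen C X x) = free_gen C XR (Inl x)"
proof -
  have "continuous_map X (free_proC_top C XR) (\<lambda>x. free_gen C XR (Inl x))" by (intro cont_intros)
  then show "free_hom X XR incl" "x \<in> topspace X \<Longrightarrow> incl (free_gen C X x) = free_gen C XR (Inl x)"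
    unfolding XR_incl_def by (rule free_hom_lift, rule lift_gen)
qed

lemma
  free_hom_\<theta>: "free_hom XR X \<theta>" and
  \<theta>_Inl: "x \<in> topspace X \<Longrightarrow> \<theta> (free_gen C XR (Inl x)) = free_gen C X x" and
  \<theta>_Inr: "\<rho> \<in> topspace R \<Longrightarrow> \<theta> (free_gen C XR (Inr \<rho>)) = \<omega> \<rho>"
proof -
  have "continuous_map XR (free_proC_top C X) (case_sum (free_gen C X) \<omega>)"
    by (intro continuous_map_from_plus_topology) (simp_all add: cont_intros)
  note * = free_hom_lift[OF this] lift_gen[OF this]
  show "free_hom XR X \<theta>" using * unfolding XR_theta_def by simp
  show "x \<in> topspace X \<Longrightarrow> \<theta> (free_gen C XR (Inl x)) = free_gen C X x"
    using *(2)[OF Inl_in_XR] unfolding XR_theta_def by simp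
  show "\<rho> \<in> topspace R \<Longrightarrow> \<theta> (free_gen C XR (Inr \<rho>)) = \<omega> \<rho>"
    using *(2)[OF Inr_in_XR] unfolding XR_theta_def by simp
qed

lemma
  free_hom_retr: "free_hom XR X retr" and
  retr_Inl: "x \<in> topspace X \<Longrightarrow> retr (free_gen C XR (Inl x)) = free_gen C X x" and
  retr_Inr: "\<rho> \<in> topspace R \<Longrightarrow> retr (free_gen C XR (Inr \<rho>)) = \<one>\<^bsub>free_proC C X\<^esub>"
proof -
  have "continuous_map XR (free_proC_top C X) (case_sum (free_gen C X) (\<lambda>_. \<one>\<^bsub>free_proC C X\<^esub>))"
    by (intro continuous_map_from_plus_topology) (simp_all add: cont_intros del: continuous_map_const)
  note * = free_hom_lift[OF this] lift_gen[OF this]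
  show "free_hom XR X retr" using * unfolding retr_def by simp
  show "x \<in> topspace X \<Longrightarrow> retr (free_gen C XR (Inl x)) = free_gen C X x"
    using *(2)[OF Inl_in_XR] unfolding retr_def by simp
  show "\<rho> \<in> topspace R \<Longrightarrow> retr (free_gen C XR (Inr \<rho>)) = \<one>\<^bsub>free_proC C X\<^esub>"
    using *(2)[OF Inr_in_XR] unfolding retr_def by simp
qed

lemma
  assumes "1 \<le> k" "k \<le> 2"
  shows free_hom_\<sigma>: "free_hom XR (Y 2) (\<sigma> k)" and
    \<sigma>_Inl: "x \<in> topspace X \<Longrightarrow> \<sigma> k (free_gen C XR (Inl x)) = free_gen C (Y 2) (Inl x)" and
    \<sigma>_Inr: "\<rho> \<in> topspace R \<Longrightarrow> \<sigma> k (free_gen C XR (Inr \<rho>)) = free_gen C (Y 2) (Inr (jump 2 k, \<rho>))"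
proof -
  have "continuous_map XR (free_proC_top C (Y 2))
      (case_sum (\<lambda>x. free_gen C (Y 2) (Inl x)) (\<lambda>\<rho>. free_gen C (Y 2) (Inr (jump 2 k, \<rho>))))"
    using assms by (intro continuous_map_from_plus_topology) (simp_all add: cont_intros)
  note * = free_hom_lift[OF this] lift_gen[OF this]
  show "free_hom XR (Y 2) (\<sigma> k)" using * unfolding \<sigma>_def by simp
  show "x \<in> topspace X \<Longrightarrow> \<sigma> k (free_gen C XR (Inl x)) = free_gen C (Y 2) (Inl x)"
    using *(2)[OF Inl_in_XR] unfolding \<sigma>_def by simp
  show "\<rho> \<in> topspace R \<Longrightarrow> \<sigma> k (free_gen C XR (Inr \<rho>)) = free_gen C (Y 2) (Inr (jump 2 k, \<rho>))"
    using *(2)[OF Inr_in_XR] unfolding \<sigma>_def by simp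
qed

lemma
  free_hom_J0: "free_hom (Y 0) X J0" and
  J0_Inl: "x \<in> topspace X \<Longrightarrow> J0 (free_gen C (Y 0) (Inl x)) = free_gen C X x"
proof -
  have "continuous_map (Y 0) (free_proC_top C X) (case_sum (free_gen C X) (\<lambda>_. \<one>\<^bsub>free_proC C X\<^esub>))"
    by (intro continuous_map_from_step1_gens) (simp_all add: cont_intros)
  note * = free_hom_lift[OF this] lift_gen[OF this]
  show "free_hom (Y 0) X J0" using * unfolding J0_def by simp
  show "x \<in> topspace X \<Longrightarrow> J0 (free_gen C (Y 0) (Inl x)) = free_gen C X x"
    using *(2)[OF Inl_in_step1_gens] unfolding J0_def by simp
qed

lemma
  free_hom_J: "free_hom (Y 1) XR J" and
  J_Inl: "x \<in> topspace X \<Longrightarrow> J (free_gen C (Y 1) (Inl x)) = free_gen C XR (Inl x)" and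
  J_Inr: "\<rho> \<in> topspace R \<Longrightarrow> J (free_gen C (Y 1) (Inr (jump 1 1, \<rho>))) = free_gen C XR (Inr \<rho>)"
proof -
  have "continuous_map (Y 1) (free_proC_top C XR)
      (case_sum (\<lambda>x. free_gen C XR (Inl x)) (\<lambda>(t, \<rho>). free_gen C XR (Inr \<rho>)))"
    by (intro continuous_map_from_step1_gens) (simp_all add: cont_intros)
  note * = free_hom_lift[OF this] lift_gen[OF this]
  show "free_hom (Y 1) XR J" using * unfolding J_def by simp
  show "x \<in> topspace X \<Longrightarrow> J (free_gen C (Y 1) (Inl x)) = free_gen C XR (Inl x)"
    using *(2)[OF Inl_in_step1_gens] unfolding J_def by simp
  show "\<rho> \<in> topspace R \<Longrightarrow> J (free_gen C (Y 1) (Inr (jump 1 1, \<rho>))) = free_gen C XR (Inr \<rho>)"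
    using *(2)[OF Inr_in_step1_gens] unfolding J_def by simp
qed

lemma
  free_hom_J_inv: "free_hom XR (Y 1) J_inv" and
  J_inv_Inl: "x \<in> topspace X \<Longrightarrow> J_inv (free_gen C XR (Inl x)) = free_gen C (Y 1) (Inl x)" and
  J_inv_Inr: "\<rho> \<in> topspace R \<Longrightarrow> J_inv (free_gen C XR (Inr \<rho>)) = free_gen C (Y 1) (Inr (jump 1 1, \<rho>))"
proof -
  have "continuous_map XR (free_proC_top C (Y 1))
      (case_sum (\<lambda>x. free_gen C (Y 1) (Inl x)) (\<lambda>\<rho>. free_gen C (Y 1) (Inr (jump 1 1, \<rho>))))"
    by (intro continuous_map_from_plus_topology) (simp_all add: cont_intros)
  note * = free_hom_lift[OF this] lift_gen[OF this]
  show "free_hom XR (Y 1) J_inv" using * unfolding J_inv_def by simp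
  show "x \<in> topspace X \<Longrightarrow> J_inv (free_gen C XR (Inl x)) = free_gen C (Y 1) (Inl x)"
    using *(2)[OF Inl_in_XR] unfolding J_inv_def by simp
  show "\<rho> \<in> topspace R \<Longrightarrow> J_inv (free_gen C XR (Inr \<rho>)) = free_gen C (Y 1) (Inr (jump 1 1, \<rho>))"
    using *(2)[OF Inr_in_XR] unfolding J_inv_def by simp
qed

lemma
  free_hom_step1_incl: "free_hom X (Y n) (step1_incl C X R n)" and
  step1_incl_gen: "x \<in> topspace X \<Longrightarrow> step1_incl C X R n (free_gen C X x) = free_gen C (Y n) (Inl x)"
proof -
  have "continuous_map X (free_proC_top C (Y n)) (\<lambda>x. free_gen C (Y n) (Inl x))" by (intro cont_intros)
  then show "free_hom X (Y n) (step1_incl C X R n)"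
    "x \<in> topspace X \<Longrightarrow> step1_incl C X R n (free_gen C X x) = free_gen C (Y n) (Inl x)"
    unfolding step1_incl_def by (rule free_hom_lift, rule lift_gen)
qed

lemma
  assumes n: "0 < n" "i \<le> n"
  shows free_hom_face: "free_hom (Y n) (Y (n - 1)) (d n i)" and
    face_Inl: "x \<in> topspace X \<Longrightarrow> d n i (free_gen C (Y n) (Inl x)) = free_gen C (Y (n - 1)) (Inl x)" and
    face_jump: "1 \<le> k \<Longrightarrow> k \<le> n \<Longrightarrow> \<rho> \<in> topspace R \<Longrightarrow>
      d n i (free_gen C (Y n) (Inr (jump n k, \<rho>))) = (let k' = if i < k then k - 1 else k in
      if k' = 0 then \<one>\<^bsub>step1_grp C X R (n - 1)\<^esub>
      else if k' = n then step1_incl C X R (n - 1) (\<omega> \<rho>)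
      else free_gen C (Y (n - 1)) (Inr (jump (n - 1) k', \<rho>)))"
proof -
  let ?f = "step1_face_gen C X R \<omega> n i"
  have "continuous_map (Y n) (free_proC_top C (Y (n - 1))) ?f"
  proof (rule continuous_map_from_step1_gens)
    show "continuous_map X (free_proC_top C (Y (n - 1))) (\<lambda>x. ?f (Inl x))"
      unfolding step1_face_gen_Inl by (intro cont_intros)
    fix k assume k: "1 \<le> k" "k \<le> n"
    define k' where "k' = (if i < k then k - 1 else k)"
    have k': "k' \<le> n - 1" if "k' \<noteq> n" using that k n by (auto simp: k'_def split: if_splits)
    have "continuous_map R (free_proC_top C (Y (n - 1))) (\<lambda>\<rho>. \<one>\<^bsub>step1_grp C X R (n - 1)\<^esub>)"
      by (intro cont_intros)
    moreover have "continuous_map R (free_proC_top C (Y (n - 1))) (\<lambda>\<rho>. step1_incl C X R (n - 1) (\<omega> \<rho>))"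
      by (intro continuous_map_free_hom[OF free_hom_step1_incl] cont_intros)
    moreover have "continuous_map R (free_proC_top C (Y (n - 1))) (\<lambda>\<rho>. free_gen C (Y (n - 1)) (Inr (jump (n - 1) k', \<rho>)))"
      if "k' \<noteq> 0" "k' \<noteq> n" using that k' by (intro cont_intros) simp_all
    ultimately show "continuous_map R (free_proC_top C (Y (n - 1))) (\<lambda>\<rho>. ?f (Inr (jump n k, \<rho>)))"
      unfolding step1_face_gen_jump[OF n(1) k n(2)] k'_def[symmetric] Let_def
      by (cases "k' = 0"; cases "k' = n") (simp_all only: if_True if_False simp_thms)
  qed
  note * = free_hom_lift[OF this] lift_gen[OF this]
  have d: "d n i = lift (Y n) (Y (n - 1)) ?f" by (simp add: step1_def)
  show "free_hom (Y n) (Y (n - 1)) (d n i)" unfolding d by (rule *)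
  show "x \<in> topspace X \<Longrightarrow> d n i (free_gen C (Y n) (Inl x)) = free_gen C (Y (n - 1)) (Inl x)"
    unfolding d by (simp only: *(2) Inl_in_step1_gens step1_face_gen_Inl)
  show "1 \<le> k \<Longrightarrow> k \<le> n \<Longrightarrow> \<rho> \<in> topspace R \<Longrightarrow>
      d n i (free_gen C (Y n) (Inr (jump n k, \<rho>))) = (let k' = if i < k then k - 1 else k in
      if k' = 0 then \<one>\<^bsub>step1_grp C X R (n - 1)\<^esub>
      else if k' = n then step1_incl C X R (n - 1) (\<omega> \<rho>)
      else free_gen C (Y (n - 1)) (Inr (jump (n - 1) k', \<rho>)))"
    unfolding d by (simp only: *(2) Inr_in_step1_gens step1_face_gen_jump[OF n(1) _ _ n(2)])
qed

lemma
  free_hom_degen: "free_hom (Y 0) (Y 1) (degen (step1 C X R \<omega>) 0 0)" and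
  degen_Inl: "x \<in> topspace X \<Longrightarrow>
    degen (step1 C X R \<omega>) 0 0 (free_gen C (Y 0) (Inl x)) = free_gen C (Y 1) (Inl x)"
proof -
  let ?f = "step1_degen_gen C X R 0 0"
  have f: "?f (Inl x) = free_gen C (Y 1) (Inl x)" for x by (simp add: step1_degen_gen_def)
  have "continuous_map (Y 0) (free_proC_top C (Y 1)) ?f"
    by (intro continuous_map_from_step1_gens) (unfold f, intro cont_intros, simp)
  note * = free_hom_lift[OF this] lift_gen[OF this]
  have d: "degen (step1 C X R \<omega>) 0 0 = lift (Y 0) (Y 1) ?f" by (simp add: step1_def)
  show "free_hom (Y 0) (Y 1) (degen (step1 C X R \<omega>) 0 0)" unfolding d by (rule *)
  show "x \<in> topspace X \<Longrightarrow>
    degen (step1 C X R \<omega>) 0 0 (free_gen C (Y 0) (Inl x)) = free_gen C (Y 1) (Inl x)"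
    unfolding d by (simp only: *(2) Inl_in_step1_gens f)
qed


section \<open>The image of the Moore complex in degree two\<close>

lemma topspace_Y1_cases:
  assumes "g \<in> topspace (Y 1)"
  obtains x where "g = Inl x" "x \<in> topspace X" | \<rho> where "g = Inr (jump 1 1, \<rho>)" "\<rho> \<in> topspace R"
  using assms by (rule topspace_step1_gens_cases) (use that in \<open>auto dest: le_antisym\<close>)

lemma topspace_Y2_cases:
  assumes "g \<in> topspace (Y 2)"
  obtains x where "g = Inl x" "x \<in> topspace X"
    | \<rho> where "g = Inr (jump 2 1, \<rho>)" "\<rho> \<in> topspace R"
    | \<rho> where "g = Inr (jump 2 2, \<rho>)" "\<rho> \<in> topspace R"
proof (rule topspace_step1_gens_cases[OF assms])
  fix k \<rho> assume "g = Inr (jump 2 k, \<rho>)" "1 \<le> k" "k \<le> 2" "\<rho> \<in> topspace R"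
  moreover from this have "k = 1 \<or> k = 2" by auto
  ultimately show thesis using that(2,3) by blast
qed (use that in blast)

lemma free_hom_eq_XR:
  assumes "free_hom XR Z f" "free_hom XR Z g"
    and "\<And>x. x \<in> topspace X \<Longrightarrow> f (free_gen C XR (Inl x)) = g (free_gen C XR (Inl x))"
    and "\<And>\<rho>. \<rho> \<in> topspace R \<Longrightarrow> f (free_gen C XR (Inr \<rho>)) = g (free_gen C XR (Inr \<rho>))"
    and "z \<in> carrier (XR_grp C X R)"
  shows "f z = g z"
  by (rule free_hom_eq[OF assms(1,2) _ assms(5)]) (use assms(3,4) in auto)

lemma \<omega>_closed: "\<rho> \<in> topspace R \<Longrightarrow> \<omega> \<rho> \<in> carrier (free_proC C X)"
  using \<omega>_cont continuous_map_image_subset_topspace topspace_free by fastforce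

section \<open>Retractions, inverses and faces of the comparison maps\<close>

lemma retr_incl: "u \<in> carrier (free_proC C X) \<Longrightarrow> retr (incl u) = u"
  by (rule free_hom_eq[OF free_hom_compose[OF free_hom_incl free_hom_retr] free_hom_id])
    (simp_all add: incl_gen retr_Inl)

lemma \<theta>_incl: "u \<in> carrier (free_proC C X) \<Longrightarrow> \<theta> (incl u) = u"
  by (rule free_hom_eq[OF free_hom_compose[OF free_hom_incl free_hom_\<theta>] free_hom_id])
    (simp_all add: incl_gen \<theta>_Inl)

lemma J0_step1_incl: "u \<in> carrier (free_proC C X) \<Longrightarrow> J0 (step1_incl C X R 0 u) = u"
  by (rule free_hom_eq[OF free_hom_compose[OF free_hom_step1_incl free_hom_J0] free_hom_id])
    (simp_all add: step1_incl_gen J0_Inl)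

lemma step1_incl_J0: "z \<in> carrier (step1_grp C X R 0) \<Longrightarrow> step1_incl C X R 0 (J0 z) = z"
  by (rule free_hom_eq[OF free_hom_compose[OF free_hom_J0 free_hom_step1_incl] free_hom_id])
    (auto elim!: topspace_step1_gens_cases simp: step1_incl_gen J0_Inl)

lemma J_step1_incl: "u \<in> carrier (free_proC C X) \<Longrightarrow> J (step1_incl C X R 1 u) = incl u"
  by (rule free_hom_eq[OF free_hom_compose[OF free_hom_step1_incl free_hom_J] free_hom_incl])
    (simp_all add: step1_incl_gen J_Inl incl_gen del: One_nat_def)

lemma J_degen_step1_incl:
  "u \<in> carrier (free_proC C X) \<Longrightarrow> J (degen (step1 C X R \<omega>) 0 0 (step1_incl C X R 0 u)) = incl u"
  by (rule free_hom_eq[OF free_hom_compose[OF free_hom_compose[OF free_hom_step1_incl free_hom_degen] free_hom_J] free_hom_incl])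
    (simp_all add: step1_incl_gen J_Inl incl_gen degen_Inl del: One_nat_def)

lemma J_J_inv: "z \<in> carrier (XR_grp C X R) \<Longrightarrow> J (J_inv z) = z"
  by (rule free_hom_eq_XR[OF free_hom_compose[OF free_hom_J_inv free_hom_J] free_hom_id])
    (simp_all add: J_inv_Inl J_inv_Inr J_Inl J_Inr del: One_nat_def)

lemma J_inv_J: "z \<in> carrier (step1_grp C X R 1) \<Longrightarrow> J_inv (J z) = z"
  by (rule free_hom_eq[OF free_hom_compose[OF free_hom_J free_hom_J_inv] free_hom_id])
    (auto elim!: topspace_Y1_cases simp: J_inv_Inl J_inv_Inr J_Inl J_Inr simp del: One_nat_def)

lemma face1_jump:
  assumes "\<rho> \<in> topspace R"
  shows "d 1 0 (free_gen C (Y 1) (Inr (jump 1 1, \<rho>))) = \<one>\<^bsub>step1_grp C X R 0\<^esub>"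
    and "d 1 1 (free_gen C (Y 1) (Inr (jump 1 1, \<rho>))) = step1_incl C X R 0 (\<omega> \<rho>)"
  using face_jump[of 1 0 1 \<rho>] face_jump[of 1 1 1 \<rho>] assms by (simp_all add: Let_def del: One_nat_def)

text \<open>\<open>jump 2 1\<close> labels s_1 of the relator and \<open>jump 2 2\<close> labels s_0
  of it. So \<open>\<omega>\<close> appears only in d_2 s_0 = s_0 d_1, and the unit only in d_0 s_1
  = s_0 d_0.\<close>

lemma face2_jump:
  assumes "\<rho> \<in> topspace R"
  shows "d 2 0 (free_gen C (Y 2) (Inr (jump 2 1, \<rho>))) = \<one>\<^bsub>step1_grp C X R 1\<^esub>"
    and "d 2 1 (free_gen C (Y 2) (Inr (jump 2 1, \<rho>))) = free_gen C (Y 1) (Inr (jump 1 1, \<rho>))"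
    and "d 2 2 (free_gen C (Y 2) (Inr (jump 2 1, \<rho>))) = free_gen C (Y 1) (Inr (jump 1 1, \<rho>))"
    and "d 2 0 (free_gen C (Y 2) (Inr (jump 2 2, \<rho>))) = free_gen C (Y 1) (Inr (jump 1 1, \<rho>))"
    and "d 2 1 (free_gen C (Y 2) (Inr (jump 2 2, \<rho>))) = free_gen C (Y 1) (Inr (jump 1 1, \<rho>))"
    and "d 2 2 (free_gen C (Y 2) (Inr (jump 2 2, \<rho>))) = step1_incl C X R 1 (\<omega> \<rho>)"
proof -
  have 21: "2 - 1 = (1::nat)" by simp
  show "d 2 0 (free_gen C (Y 2) (Inr (jump 2 1, \<rho>))) = \<one>\<^bsub>step1_grp C X R 1\<^esub>"
    "d 2 1 (free_gen C (Y 2) (Inr (jump 2 1, \<rho>))) = free_gen C (Y 1) (Inr (jump 1 1, \<rho>))"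
    "d 2 2 (free_gen C (Y 2) (Inr (jump 2 1, \<rho>))) = free_gen C (Y 1) (Inr (jump 1 1, \<rho>))"
    "d 2 0 (free_gen C (Y 2) (Inr (jump 2 2, \<rho>))) = free_gen C (Y 1) (Inr (jump 1 1, \<rho>))"
    "d 2 1 (free_gen C (Y 2) (Inr (jump 2 2, \<rho>))) = free_gen C (Y 1) (Inr (jump 1 1, \<rho>))"
    "d 2 2 (free_gen C (Y 2) (Inr (jump 2 2, \<rho>))) = step1_incl C X R 1 (\<omega> \<rho>)"
    using face_jump[of 2 0 1 \<rho>, unfolded 21] face_jump[of 2 1 1 \<rho>, unfolded 21]
      face_jump[of 2 2 1 \<rho>, unfolded 21] face_jump[of 2 0 2 \<rho>, unfolded 21]
      face_jump[of 2 1 2 \<rho>, unfolded 21] face_jump[of 2 2 2 \<rho>, unfolded 21] assms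
    by (simp_all add: Let_def 21 del: One_nat_def)
qed

lemma
  free_hom_face1: "i \<le> 1 \<Longrightarrow> free_hom (Y 1) (Y 0) (d 1 i)" and
  face1_Inl: "i \<le> 1 \<Longrightarrow> x \<in> topspace X \<Longrightarrow> d 1 i (free_gen C (Y 1) (Inl x)) = free_gen C (Y 0) (Inl x)"
  using free_hom_face[of 1 i] face_Inl[of 1 i x] by (simp_all del: One_nat_def)

lemma
  free_hom_face2: "i \<le> 2 \<Longrightarrow> free_hom (Y 2) (Y 1) (d 2 i)" and
  face2_Inl: "i \<le> 2 \<Longrightarrow> x \<in> topspace X \<Longrightarrow> d 2 i (free_gen C (Y 2) (Inl x)) = free_gen C (Y 1) (Inl x)"
proof -
  have 21: "2 - 1 = (1::nat)" by simp
  show "i \<le> 2 \<Longrightarrow> free_hom (Y 2) (Y 1) (d 2 i)"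
    "i \<le> 2 \<Longrightarrow> x \<in> topspace X \<Longrightarrow> d 2 i (free_gen C (Y 2) (Inl x)) = free_gen C (Y 1) (Inl x)"
    using free_hom_face[of 2 i, unfolded 21] face_Inl[of 2 i x, unfolded 21] by simp_all
qed

lemma J0_face_0: "z \<in> carrier (step1_grp C X R 1) \<Longrightarrow> J0 (d 1 0 z) = retr (J z)"
  by (rule free_hom_eq[OF free_hom_compose[OF free_hom_face1 free_hom_J0] free_hom_compose[OF free_hom_J free_hom_retr]])
    (auto elim!: topspace_Y1_cases simp: face1_Inl face1_jump J0_Inl J_Inl J_Inr retr_Inl retr_Inr
      free_hom_one[OF free_hom_J0] simp del: One_nat_def)

lemma J0_face_1: "z \<in> carrier (step1_grp C X R 1) \<Longrightarrow> J0 (d 1 1 z) = \<theta> (J z)"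
  by (rule free_hom_eq[OF free_hom_compose[OF free_hom_face1 free_hom_J0] free_hom_compose[OF free_hom_J free_hom_\<theta>]])
    (auto elim!: topspace_Y1_cases simp: face1_Inl face1_jump J0_Inl J_Inl J_Inr \<theta>_Inl \<theta>_Inr
      J0_step1_incl \<omega>_closed simp del: One_nat_def)

text \<open>Degrees 1 and 0 in the coordinates X + R and X, with d_0, d_1 and s_0 read as
  \<open>retr\<close>, \<open>\<theta>\<close> and \<open>incl\<close>.\<close>

sublocale refl: reflexive_topological_group "XR_grp C X R" "XR_top C X R" "free_proC C X" "free_proC_top C X" retr \<theta> incl
  using free_hom_retr free_hom_\<theta> free_hom_incl
  by unfold_locales (simp_all add: free_proC_topological closed_C free_proC_Hausdorff retr_incl \<theta>_incl free_hom_def)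

abbreviation \<delta> :: "nat \<Rightarrow> ('x, 'r) gens fpc \<Rightarrow> ('x + 'r) fpc" where
  "\<delta> i z \<equiv> J (d 2 i z)"

lemma free_hom_\<delta>: "i \<le> 2 \<Longrightarrow> free_hom (Y 2) XR (\<delta> i)"
  by (rule free_hom_compose[OF free_hom_face2 free_hom_J])

lemmas one_simps = free_hom_one[OF free_hom_J] free_hom_one[OF free_hom_\<theta>] free_hom_one[OF free_hom_incl]
  free_hom_one[OF free_hom_retr]

lemmas gen_simps = face2_Inl face2_jump J_Inl J_Inr J_step1_incl \<omega>_closed one_simps
  \<theta>_Inl \<theta>_Inr retr_Inl retr_Inr incl_gen retr_incl \<theta>_incl

text \<open>The simplicial identities for d_i s_j from degree 1 through degree 2, with
  \<open>\<sigma> 2\<close> as s_0 and \<open>\<sigma> 1\<close> as s_1.\<close>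

lemma \<delta>_\<sigma>:
  assumes "a \<in> carrier (XR_grp C X R)"
  shows "\<delta> 0 (\<sigma> 2 a) = a" "\<delta> 1 (\<sigma> 2 a) = a" "\<delta> 2 (\<sigma> 2 a) = incl (\<theta> a)"
    "\<delta> 0 (\<sigma> 1 a) = incl (retr a)" "\<delta> 1 (\<sigma> 1 a) = a" "\<delta> 2 (\<sigma> 1 a) = a"
proof -
  have *: "\<delta> i (\<sigma> k a) = g a" if "i \<le> 2" "1 \<le> k" "k \<le> 2" "free_hom XR XR g"
    "\<And>x. x \<in> topspace X \<Longrightarrow> \<delta> i (free_gen C (Y 2) (Inl x)) = g (free_gen C XR (Inl x))"
    "\<And>\<rho>. \<rho> \<in> topspace R \<Longrightarrow> \<delta> i (free_gen C (Y 2) (Inr (jump 2 k, \<rho>))) = g (free_gen C XR (Inr \<rho>))" for i k g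
    by (rule free_hom_eq_XR[OF free_hom_compose[OF free_hom_\<sigma>[OF that(2,3)] free_hom_\<delta>[OF that(1)]] that(4) _ _ assms])
      (simp_all only: \<sigma>_Inl[OF that(2,3)] \<sigma>_Inr[OF that(2,3)] that)
  note id = free_hom_id[of XR] and e\<theta> = free_hom_compose[OF free_hom_\<theta> free_hom_incl]
    and er = free_hom_compose[OF free_hom_retr free_hom_incl]
  show "\<delta> 0 (\<sigma> 2 a) = a" by (rule *[OF _ _ _ id]) (simp_all add: gen_simps del: One_nat_def)
  show "\<delta> 1 (\<sigma> 2 a) = a" by (rule *[OF _ _ _ id]) (simp_all add: gen_simps del: One_nat_def)
  show "\<delta> 2 (\<sigma> 2 a) = incl (\<theta> a)" by (rule *[OF _ _ _ e\<theta>]) (simp_all add: gen_simps del: One_nat_def)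
  show "\<delta> 0 (\<sigma> 1 a) = incl (retr a)" by (rule *[OF _ _ _ er]) (simp_all add: gen_simps del: One_nat_def)
  show "\<delta> 1 (\<sigma> 1 a) = a" by (rule *[OF _ _ _ id]) (simp_all add: gen_simps del: One_nat_def)
  show "\<delta> 2 (\<sigma> 1 a) = a" by (rule *[OF _ _ _ id]) (simp_all add: gen_simps del: One_nat_def)
qed

lemma \<theta>_\<delta>_0: "z \<in> carrier (step1_grp C X R 2) \<Longrightarrow> \<theta> (\<delta> 0 z) = retr (\<delta> 2 z)"
  by (rule free_hom_eq[OF free_hom_compose[OF free_hom_\<delta> free_hom_\<theta>] free_hom_compose[OF free_hom_\<delta> free_hom_retr]])
    (auto elim!: topspace_Y2_cases simp: gen_simps simp del: One_nat_def)

lemma image_\<delta>_2_eq: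
  "\<delta> 2 ` {z \<in> carrier (step1_grp C X R 2). \<delta> 0 z = \<one>\<^bsub>XR_grp C X R\<^esub> \<and> \<delta> 1 z = \<one>\<^bsub>XR_grp C X R\<^esub>} = refl.peiffer_span"
proof (rule refl.image_moore2_eq_peiffer_span[where d = \<delta> and sl = "\<sigma> 2" and sr = "\<sigma> 1"])
  show "\<delta> i \<in> hom (step1_grp C X R 2) (XR_grp C X R)"
    "continuous_map (step1_top C X R 2) (XR_top C X R) (\<delta> i)" if "i \<le> 2" for i
    using free_hom_\<delta>[OF that] by (simp_all add: free_hom_def)
  show "\<sigma> 2 \<in> hom (XR_grp C X R) (step1_grp C X R 2)" "\<sigma> 1 \<in> hom (XR_grp C X R) (step1_grp C X R 2)"
    using free_hom_\<sigma>[of 2] free_hom_\<sigma>[of 1] by (simp_all add: free_hom_def)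
  \<comment> \<open>A generator x gives x x^-1 x. For s_1 of a relator the last two factors are
    trivial; for s_0 of it the first two cancel and \<open>\<delta> 0\<close> returns the
    relator.\<close>
  fix y assume "y \<in> topspace (Y 2)"
  then show "\<delta> 1 (free_gen C (Y 2) y) =
      \<delta> 2 (free_gen C (Y 2) y) \<otimes>\<^bsub>XR_grp C X R\<^esub>
      inv\<^bsub>XR_grp C X R\<^esub> (incl (retr (\<delta> 2 (free_gen C (Y 2) y)))) \<otimes>\<^bsub>XR_grp C X R\<^esub>
      \<delta> 0 (free_gen C (Y 2) y)"
    by (rule topspace_Y2_cases)
      (use \<omega>_closed in \<open>simp_all add: gen_simps gen_in_free gens_in del: One_nat_def topspace_plus_topology\<close>)
qed (simp_all add: closed_C free_proC_Hausdorff \<delta>_\<sigma> \<theta>_\<delta>_0 del: One_nat_def)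


section \<open>The comparison isomorphism\<close>

text \<open>Modulo any closed normal subgroup containing the relators, the identity and
  \<open>incl\<close> after \<open>retr\<close> agree on generators, hence everywhere; on the kernel
  of \<open>retr\<close> the second map is trivial.\<close>

lemma rel_carrier_eq: "rel_carrier C X R = refl.ker"
proof
  let ?S = "(\<lambda>\<rho>. free_gen C XR (Inr \<rho>)) ` topspace R"
  have "?S \<subseteq> refl.ker"
    using gen_in_free[OF Inr_in_XR] by (auto simp: refl.ker_iff retr_Inr)
  then show "rel_carrier C X R \<subseteq> refl.ker"
    using refl.src.normal_kernel refl.closedin_ker unfolding rel_carrier_def closed_normal_span_def by blast
  have "z \<in> N" if z: "z \<in> refl.ker" and N: "N \<lhd> XR_grp C X R" "closedin (XR_top C X R) N" "?S \<subseteq> N" for z N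
  proof -
    let ?A = "XR_grp C X R"
    interpret N: normal N ?A by (rule N)
    have er: "free_hom XR XR (\<lambda>z. incl (retr z))" by (rule free_hom_compose[OF free_hom_retr free_hom_incl])
    have coset_hom: "(\<lambda>z. N #>\<^bsub>?A\<^esub> f z) \<in> hom ?A (?A Mod N)" if "free_hom XR XR f" for f
      using hom_compose[of f ?A, OF _ N.r_coset_hom_Mod] that by (simp add: free_hom_def o_def)
    have "z \<otimes>\<^bsub>?A\<^esub> inv\<^bsub>?A\<^esub> (incl (retr z)) \<in> N"
    proof (rule free_proC_coset_eq[OF closed_C refl.topA N(1,2) _ coset_hom[OF free_hom_id] _ coset_hom[OF er]])
      show "free_gen C XR y \<otimes>\<^bsub>?A\<^esub> inv\<^bsub>?A\<^esub> (incl (retr (free_gen C XR y))) \<in> N" if "y \<in> topspace XR" for y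
        using that N(3) gen_in_free[OF Inl_in_XR] gen_in_free[OF Inr_in_XR]
        by (auto simp: retr_Inl retr_Inr incl_gen one_simps)
    qed (use z er in \<open>simp_all add: free_hom_def refl.ker_iff\<close>)
    then show ?thesis using z by (simp add: refl.ker_iff one_simps)
  qed
  then show "refl.ker \<subseteq> rel_carrier C X R"
    unfolding rel_carrier_def closed_normal_span_def by blast
qed

lemma rel_grp_eq: "rel_grp C X R = refl.ker_grp"
  by (simp add: rel_grp_def rel_carrier_eq)

lemma rel_top_eq: "rel_top C X R = refl.ker_top"
  by (simp add: rel_top_def rel_carrier_eq)

text \<open>\<open>peiffer_comm\<close> takes its inverses in the subgroup,
  \<open>refl.peiffer\<close> in the ambient group; they agree once the translate of
  \<open>b\<close> is known to lie in the kernel.\<close>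

lemma peiffer_comm_eq:
  assumes "a \<in> refl.ker" "b \<in> refl.ker"
  shows "peiffer_comm C X R \<omega> a b = refl.peiffer a b"
proof -
  have "conj_by (XR_grp C X R) (incl (\<theta> a)) b \<in> refl.ker"
    by (rule refl.conj_in_ker) (use assms in \<open>simp_all add: refl.ker_iff\<close>)
  then show ?thesis
    using assms by (simp add: peiffer_comm_def refl.peiffer_def rel_act_def conj_by_def rel_grp_eq
        refl.A.m_inv_consistent[OF refl.subgroup_ker])
qed

lemma peiffer_sub_eq: "peiffer_sub C X R \<omega> = refl.peiffer_span"
proof -
  have "{peiffer_comm C X R \<omega> a b | a b. a \<in> refl.ker \<and> b \<in> refl.ker} =
      {refl.peiffer a b | a b. a \<in> refl.ker \<and> b \<in> refl.ker}"
    by (rule Collect_cong) (metis peiffer_comm_eq)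
  then show ?thesis
    by (simp add: peiffer_sub_def refl.peiffer_span_def rel_grp_eq rel_top_eq rel_carrier_eq)
qed

text \<open>The kernel of Theta on H: edges that start and end at the identity vertex. These become
  the degree-1 cycles under \<open>J\<close> and the identities after dividing by the Peiffer
  span.\<close>

definition loops :: "('x + 'r) fpc set" where
  "loops = {h \<in> refl.ker. \<theta> h = \<one>\<^bsub>free_proC C X\<^esub>}"

lemma loops_eq: "loops = refl.ker \<inter> kernel (XR_grp C X R) (free_proC C X) \<theta>"
  by (auto simp: loops_def kernel_def)

lemma subgroup_loops: "subgroup loops refl.ker_grp"
  unfolding loops_eq
  by (rule refl.A.subgroup_incl[OF refl.A.subgroups_Inter_pair[OF refl.subgroup_ker refl.tgt.subgroup_kernel] refl.subgroup_ker]) simp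

lemma closedin_loops: "closedin refl.ker_top loops"
  unfolding loops_eq closedin_subtopology
  using refl.closedin_kernel[OF refl.tgt_hom refl.tgt_cont] by blast

lemma peiffer_span_subset_loops: "refl.peiffer_span \<subseteq> loops"
  using refl.peiffer_span_subset_ker refl.tgt_peiffer_span by (auto simp: loops_def)

lemma normal_peiffer_span_ker: "refl.peiffer_span \<lhd> refl.ker_grp"
  by (rule refl.A.normal_restrict_supergroup[OF refl.subgroup_ker refl.normal_peiffer_span refl.peiffer_span_subset_ker])

text \<open>Theta is constant on each coset because it kills the Peiffer span, so
  \<open>the_elem\<close> in the boundary map picks the value at any representative.\<close>

lemma identities_carrier_eq:
  "identities_carrier C X R \<omega> = (\<lambda>h. refl.peiffer_span #>\<^bsub>refl.ker_grp\<^esub> h) ` loops"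
proof -
  have "xmod_boundary C X R \<omega> (refl.peiffer_span #>\<^bsub>refl.ker_grp\<^esub> h) = \<theta> h" if h: "h \<in> refl.ker" for h
  proof -
    have "\<theta> (p \<otimes>\<^bsub>XR_grp C X R\<^esub> h) = \<theta> h" if "p \<in> refl.peiffer_span" for p
      using that h refl.tgt_peiffer_span[OF that] refl.peiffer_span_subset_ker by (auto simp: refl.ker_iff)
    moreover have "refl.peiffer_span \<noteq> {}"
      using subgroup.one_closed[OF refl.subgroup_peiffer_span] by blast
    ultimately have "\<theta> ` (refl.peiffer_span #>\<^bsub>refl.ker_grp\<^esub> h) = {\<theta> h}"
      by (auto simp: r_coset_def image_UN)
    then show ?thesis by (simp add: xmod_boundary_def)
  qed
  then show ?thesis
    unfolding identities_carrier_def kernel_def xmod_grp_def rel_grp_eq peiffer_sub_eq carrier_FactGroup loops_def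
    by auto
qed

lemma identities_grp_eq: "identities_grp C X R \<omega> = (refl.ker_grp Mod refl.peiffer_span)
    \<lparr>carrier := (\<lambda>h. refl.peiffer_span #>\<^bsub>refl.ker_grp\<^esub> h) ` loops\<rparr>"
  by (simp only: identities_grp_def xmod_grp_def rel_grp_eq peiffer_sub_eq identities_carrier_eq)

lemma identities_top_eq: "identities_top C X R \<omega> =
    subtopology (quotient_topology refl.ker_grp refl.ker_top refl.peiffer_span)
      ((\<lambda>h. refl.peiffer_span #>\<^bsub>refl.ker_grp\<^esub> h) ` loops)"
  by (simp only: identities_top_def xmod_top_def rel_grp_eq rel_top_eq peiffer_sub_eq identities_carrier_eq)

section \<open>Cycles and boundaries in degree 1\<close>

lemma sgrp_step1: "sgrp (step1 C X R \<omega>) n = step1_grp C X R n" and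
  stop_step1: "stop (step1 C X R \<omega>) n = step1_top C X R n"
  by (simp_all add: step1_def)

lemma inj_J: "inj_on J (carrier (step1_grp C X R 1))"
  by (rule inj_on_inverseI[of _ J_inv]) (rule J_inv_J)

lemma homeomorphic_maps_J: "homeomorphic_maps (step1_top C X R 1) (XR_top C X R) J J_inv"
  using free_hom_J free_hom_J_inv
  by (simp add: homeomorphic_maps_def free_hom_def topspace_free J_inv_J J_J_inv del: One_nat_def)

lemma J_eq_one_iff:
  "z \<in> carrier (step1_grp C X R 1) \<Longrightarrow> J z = \<one>\<^bsub>XR_grp C X R\<^esub> \<longleftrightarrow> z = \<one>\<^bsub>step1_grp C X R 1\<^esub>"
  by (metis J_inv_J free_hom_one[OF free_hom_J] free_hom_one[OF free_hom_J_inv])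

lemma J0_eq_one_iff:
  "z \<in> carrier (step1_grp C X R 0) \<Longrightarrow> J0 z = \<one>\<^bsub>free_proC C X\<^esub> \<longleftrightarrow> z = \<one>\<^bsub>step1_grp C X R 0\<^esub>"
  by (metis step1_incl_J0 free_hom_one[OF free_hom_J0] free_hom_one[OF free_hom_step1_incl])

lemma moore_cycles_eq: "moore_cycles (step1 C X R \<omega>) 1 = {z \<in> carrier (step1_grp C X R 1). J z \<in> loops}"
proof -
  have "z \<in> moore_cycles (step1 C X R \<omega>) 1 \<longleftrightarrow> J z \<in> loops" if z: "z \<in> carrier (step1_grp C X R 1)" for z
  proof -
    have c: "d 1 0 z \<in> carrier (step1_grp C X R 0)" "d 1 1 z \<in> carrier (step1_grp C X R 0)"
      using free_hom_closed[OF free_hom_face1 z] by (simp_all del: One_nat_def)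
    have "z \<in> moore_cycles (step1 C X R \<omega>) 1 \<longleftrightarrow>
        d 1 0 z = \<one>\<^bsub>step1_grp C X R 0\<^esub> \<and> d 1 1 z = \<one>\<^bsub>step1_grp C X R 0\<^esub>"
      using z by (simp add: moore_cycles_def moore_def sgrp_step1)
    also have "\<dots> \<longleftrightarrow> J z \<in> loops"
      using free_hom_closed[OF free_hom_J z]
      by (simp only: J0_eq_one_iff[OF c(1), symmetric] J0_eq_one_iff[OF c(2), symmetric] J0_face_0[OF z] J0_face_1[OF z])
        (simp add: loops_def refl.ker_iff)
    finally show ?thesis .
  qed
  moreover have "moore_cycles (step1 C X R \<omega>) 1 \<subseteq> carrier (step1_grp C X R 1)"
    by (auto simp: moore_cycles_def moore_def sgrp_step1)
  ultimately show ?thesis by blast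
qed

lemma image_moore_boundaries: "J ` moore_boundaries (step1 C X R \<omega>) 1 = refl.peiffer_span"
proof -
  \<comment> \<open>Injectivity of \<open>J\<close> turns the Moore conditions on the faces into the
    conditions on \<open>\<delta>\<close> for which the image is known.\<close>
  have "d 2 i z = \<one>\<^bsub>step1_grp C X R 1\<^esub> \<longleftrightarrow> \<delta> i z = \<one>\<^bsub>XR_grp C X R\<^esub>"
    if "z \<in> carrier (step1_grp C X R 2)" "i \<le> 2" for i z
    by (rule J_eq_one_iff[symmetric, OF free_hom_closed[OF free_hom_face2 that(1)], OF that(2)])
  moreover have "(\<forall>i<2. P i) \<longleftrightarrow> P 0 \<and> P 1" for P :: "nat \<Rightarrow> bool"
    by (auto simp: less_2_cases_iff)
  ultimately have "moore (step1 C X R \<omega>) 2 =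
      {z \<in> carrier (step1_grp C X R 2). \<delta> 0 z = \<one>\<^bsub>XR_grp C X R\<^esub> \<and> \<delta> 1 z = \<one>\<^bsub>XR_grp C X R\<^esub>}"
    by (auto simp: moore_def sgrp_step1)
  moreover have "J ` moore_boundaries (step1 C X R \<omega>) 1 = \<delta> 2 ` moore (step1 C X R \<omega>) 2"
    by (simp add: moore_boundaries_def image_image numeral_2_eq_2)
  ultimately show ?thesis by (simp only: image_\<delta>_2_eq)
qed

lemma moore_boundaries_subset: "moore_boundaries (step1 C X R \<omega>) 1 \<subseteq> moore_cycles (step1 C X R \<omega>) 1"
proof
  fix z assume z: "z \<in> moore_boundaries (step1 C X R \<omega>) 1"
  then have "z \<in> carrier (step1_grp C X R 1)"
    using free_hom_closed[OF free_hom_face2, of 2]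
    by (auto simp: moore_boundaries_def moore_def sgrp_step1 numeral_2_eq_2)
  moreover have "J z \<in> loops"
    using z image_moore_boundaries peiffer_span_subset_loops by blast
  ultimately show "z \<in> moore_cycles (step1 C X R \<omega>) 1" by (simp add: moore_cycles_eq del: One_nat_def)
qed

lemma image_moore_cycles: "J ` moore_cycles (step1 C X R \<omega>) 1 = loops"
proof
  show "J ` moore_cycles (step1 C X R \<omega>) 1 \<subseteq> loops" by (auto simp: moore_cycles_eq simp del: One_nat_def)
  show "loops \<subseteq> J ` moore_cycles (step1 C X R \<omega>) 1"
  proof
    fix h assume h: "h \<in> loops"
    then have hc: "h \<in> carrier (XR_grp C X R)" by (simp add: loops_def refl.ker_iff)
    show "h \<in> J ` moore_cycles (step1 C X R \<omega>) 1"
      by (rule image_eqI[of _ _ "J_inv h"])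
        (use h hc J_J_inv free_hom_closed[OF free_hom_J_inv] in \<open>simp_all add: moore_cycles_eq del: One_nat_def\<close>)
  qed
qed

text \<open>All three claims come from \<open>J\<close> acting on cosets as sets: it carries the
  cycles onto \<open>loops\<close>, the boundaries onto the Peiffer span, and the degeneracy of
  \<open>u\<close> to \<open>incl u\<close>.\<close>

theorem homotopy1_iso_identities:
  "image J \<in> iso (homotopy_grp (step1 C X R \<omega>) 1) (identities_grp C X R \<omega>)"
  "homeomorphic_map (homotopy_top (step1 C X R \<omega>) 1) (identities_top C X R \<omega>) (image J)"
  "u \<in> carrier (free_proC C X) \<Longrightarrow> A \<in> carrier (homotopy_grp (step1 C X R \<omega>) 1) \<Longrightarrow>
    J ` homotopy1_act (step1 C X R \<omega>) (step1_incl C X R 0 u) A = xmod_act C X R u (J ` A)"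
proof -
  let ?F = "step1_grp C X R 1" and ?A = "XR_grp C X R"
  let ?Z = "moore_cycles (step1 C X R \<omega>) 1" and ?B = "moore_boundaries (step1 C X R \<omega>) 1"
  let ?S = "cycle_grp (step1 C X R \<omega>) 1" and ?TS = "subtopology (step1_top C X R 1) ?Z"
  interpret J: group_hom ?F ?A J by (rule free_hom_group_hom[OF free_hom_J])
  have ZF: "?Z \<subseteq> carrier ?F" by (auto simp: moore_cycles_eq simp del: One_nat_def)
  have cS: "carrier ?S = ?Z" by (simp add: cycle_grp_def)
  have S_eq: "?S = ?F\<lparr>carrier := ?Z\<rparr>" by (simp add: cycle_grp_def sgrp_step1)
  have subA: "subgroup loops ?A" by (rule refl.A.incl_subgroup[OF refl.subgroup_ker subgroup_loops])
  have "subgroup ?Z ?F"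
  proof (rule J.G.subgroupI)
    show "?Z \<noteq> {}" using image_moore_cycles subgroup.one_closed[OF subA] by blast
    show "inv\<^bsub>?F\<^esub> a \<in> ?Z" if "a \<in> ?Z" for a
      using that subgroup.m_inv_closed[OF subA] by (simp add: moore_cycles_eq del: One_nat_def)
    show "a \<otimes>\<^bsub>?F\<^esub> b \<in> ?Z" if "a \<in> ?Z" "b \<in> ?Z" for a b
      using that subgroup.m_closed[OF subA] by (simp add: moore_cycles_eq del: One_nat_def)
  qed (rule ZF)
  then have gS: "group ?S" unfolding S_eq by (rule J.G.subgroup_imp_group)
  have tS: "topspace ?TS = carrier ?S" using ZF by (simp add: cS topspace_free inf.absorb2 del: One_nat_def)
  have J_iso: "J \<in> iso ?S (refl.ker_grp\<lparr>carrier := loops\<rparr>)"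
  proof (rule isoI)
    show "J \<in> hom ?S (refl.ker_grp\<lparr>carrier := loops\<rparr>)"
    proof (rule homI)
      show "J x \<in> carrier (refl.ker_grp\<lparr>carrier := loops\<rparr>)" if "x \<in> carrier ?S" for x
        using imageI[OF that, of J] image_moore_cycles by (simp add: cS del: One_nat_def)
      show "J (x \<otimes>\<^bsub>?S\<^esub> y) = J x \<otimes>\<^bsub>refl.ker_grp\<lparr>carrier := loops\<rparr>\<^esub> J y"
        if "x \<in> carrier ?S" "y \<in> carrier ?S" for x y
        using that subsetD[OF ZF] by (simp add: S_eq del: One_nat_def)
    qed
    show "bij_betw J (carrier ?S) (carrier (refl.ker_grp\<lparr>carrier := loops\<rparr>))"
      using image_moore_cycles inj_on_subset[OF inj_J ZF] by (simp add: bij_betw_def cS del: One_nat_def)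
  qed
  have LK: "loops \<subseteq> refl.ker" by (auto simp: loops_def)
  have "homeomorphic_map ?TS (subtopology (XR_top C X R) loops) J"
  proof (rule homeomorphic_map_subtopologies)
    show "homeomorphic_map (step1_top C X R 1) (XR_top C X R) J"
      unfolding homeomorphic_map_maps using homeomorphic_maps_J by blast
    show "J ` (topspace (step1_top C X R 1) \<inter> ?Z) = topspace (XR_top C X R) \<inter> loops"
      unfolding topspace_free using image_moore_cycles
      by (simp only: inf.absorb2[OF ZF] inf.absorb2[OF subgroup.subset[OF subA]])
  qed
  then have J_homeo: "homeomorphic_map ?TS (subtopology refl.ker_top loops) J"
    using LK by (simp add: subtopology_subtopology inf.absorb2)
  \<comment> \<open>Listed in the order of the premises shared by \<open>quotient_iso_image\<close>
    and \<open>quotient_homeomorphic_map_image\<close>.\<close>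
  note facts = topological_groupD[OF refl.topological_group_ker] normal_peiffer_span_ker
    subgroup_loops peiffer_span_subset_loops closedin_loops gS tS
    moore_boundaries_subset[folded cS] image_moore_boundaries J_iso J_homeo
  show "image J \<in> iso (homotopy_grp (step1 C X R \<omega>) 1) (identities_grp C X R \<omega>)"
    unfolding homotopy_grp_def identities_grp_eq by (rule quotient_iso_image[OF facts])
  show "homeomorphic_map (homotopy_top (step1 C X R \<omega>) 1) (identities_top C X R \<omega>) (image J)"
    unfolding homotopy_top_def identities_top_eq stop_step1 by (rule quotient_homeomorphic_map_image[OF facts])
  assume u: "u \<in> carrier (free_proC C X)" and A: "A \<in> carrier (homotopy_grp (step1 C X R \<omega>) 1)"
  interpret S: group ?S by (rule gS)
  have AF: "A \<subseteq> carrier ?F"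
    using A S.r_coset_subset_G[OF moore_boundaries_subset[folded cS]] ZF cS
    unfolding homotopy_grp_def carrier_FactGroup by blast
  let ?g = "degen (step1 C X R \<omega>) 0 0 (step1_incl C X R 0 u)"
  have g: "?g \<in> carrier ?F" "J ?g = incl u"
    using free_hom_closed[OF free_hom_degen free_hom_closed[OF free_hom_step1_incl u]] J_degen_step1_incl[OF u]
    by simp_all
  have "J (conj_by ?F ?g a) = rel_act C X R u (J a)" if "a \<in> A" for a
    using that AF g by (simp add: conj_by_def rel_act_def subset_iff del: One_nat_def)
  then show "J ` homotopy1_act (step1 C X R \<omega>) (step1_incl C X R 0 u) A = xmod_act C X R u (J ` A)"
    by (simp add: homotopy1_act_def xmod_act_def image_image sgrp_step1 del: One_nat_def)
qed

end

text \<open>Nonemptiness of the class comes from G: its whole space is a neighbourhood of the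
  identity, so it contains an open normal subgroup with quotient in the class.\<close>

lemma relator_map_of_presentation:
  assumes "closed_class C" "proC_presentation C X R \<omega> G TG"
  shows "relator_map C X R \<omega>"
proof
  have "proC_group C G TG" using assms(2) by (simp add: proC_presentation_def)
  then obtain N where "in_class C (G Mod N)"
    unfolding proC_group_def topological_group_def
    by (metis group.is_monoid monoid.one_closed openin_topspace)
  then show "C \<noteq> {}" by (auto simp: in_class_def)
qed (use assms in \<open>simp_all add: proC_presentation_def\<close>)

theorem mainTheorem7:
  fixes C :: "nat monoid set"
    and X :: "'x topology" and R :: "'r topology" and \<omega> :: "'r \<Rightarrow> 'x fpc"
    and G :: "('g, 'm) monoid_scheme" and TG :: "'g topology"
  assumes "closed_class C"
    and "proC_presentation C X R \<omega> G TG"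
  shows "\<exists>\<phi>. \<phi> \<in> iso (homotopy_grp (step1 C X R \<omega>) 1) (identities_grp C X R \<omega>) \<and>
     homeomorphic_map (homotopy_top (step1 C X R \<omega>) 1) (identities_top C X R \<omega>) \<phi> \<and>
     (\<forall>u \<in> carrier (free_proC C X). \<forall>z \<in> carrier (homotopy_grp (step1 C X R \<omega>) 1).
        \<phi> (homotopy1_act (step1 C X R \<omega>) (step1_incl C X R 0 u) z) = xmod_act C X R u (\<phi> z))"
proof -
  interpret relator_map C X R \<omega> by (rule relator_map_of_presentation[OF assms])
  show ?thesis using homotopy1_iso_identities by blast
qed

end
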